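(* Let $\theta>0$, $c_n=\langle n\rangle^{-(\frac12+\theta)}$ for $n\in\mathbb{Z}$, $z_0>0$, and let $u_0=\sum_{n\in\mathbb{Z}}c_ng_ne^{inx}$, where $(g_n)_{n\in\mathbb{Z}}$ are i.i.d. standard complex Gaussian random variables. Let $T_\epsilon>0$ with $T_\epsilon=O(\epsilon^{-1})$. Then $$\lim_{\epsilon\to0^+}\epsilon\,\ln\mathbb{P}\Big(\|e^{it\Delta}u_0\|_{L^\infty_{t,x}([0,T_\epsilon]\times\mathbb{T})}>z_0\epsilon^{-\frac12}\Big)=-\frac{z_0^2}{\sum_{n\in\mathbb{Z}}c_n^2}.$$
   Context: $\mathbb{T}=\mathbb{R}/2\pi\mathbb{Z}$, $\Delta=\partial_x^2$, $\langle n\rangle=(1+|n|^2)^{1/2}$, and $e^{it\Delta}u_0=\sum_nc_ng_ne^{inx-itn^2}$. A standard complex Gaussian $g$ is a centered circularly symmetric complex Gaussian with $\mathbb{E}|g|^2=1$. $T_\epsilon=O(\epsilon^{-1})$ means $T_\epsilon\le K\epsilon^{-1}$ with $K$ independent of $\epsilon$. *)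

theory Defs
  imports "HOL-Probability.Probability" "HOL-Library.Landau_Symbols"
begin

section \<open>Standard complex Gaussian random variables\<close>

text \<open>Constants count as (degenerate) real Gaussians, so that joint Gaussianity of
  real and imaginary part can be expressed through their real linear combinations.\<close>

definition real_gaussian :: "'w measure \<Rightarrow> ('w \<Rightarrow> real) \<Rightarrow> bool" where
  "real_gaussian M X \<longleftrightarrow>
     (\<exists>\<mu> \<sigma>. \<sigma> > 0 \<and> distributed M lborel X (\<lambda>x. ennreal (normal_density \<mu> \<sigma> x))) \<or>
     (X \<in> borel_measurable M \<and> (\<exists>\<mu>. AE \<omega> in M. X \<omega> = \<mu>))"

definition complex_gaussian :: "'w measure \<Rightarrow> ('w \<Rightarrow> complex) \<Rightarrow> bool" where
  "complex_gaussian M g \<longleftrightarrow>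
     g \<in> borel_measurable M \<and>
     (\<forall>a b :: real. real_gaussian M (\<lambda>\<omega>. a * Re (g \<omega>) + b * Im (g \<omega>)))"

definition circularly_symmetric :: "'w measure \<Rightarrow> ('w \<Rightarrow> complex) \<Rightarrow> bool" where
  "circularly_symmetric M g \<longleftrightarrow>
     (\<forall>\<phi> :: real. distr M borel (\<lambda>\<omega>. cis \<phi> * g \<omega>) = distr M borel g)"

definition standard_complex_gaussian :: "'w measure \<Rightarrow> ('w \<Rightarrow> complex) \<Rightarrow> bool" where
  "standard_complex_gaussian M g \<longleftrightarrow>
     complex_gaussian M g \<and> circularly_symmetric M g \<and>
     integral\<^sup>L M g = 0 \<and> integral\<^sup>L M (\<lambda>\<omega>. (norm (g \<omega>))\<^sup>2) = 1"


section \<open>Fourier series and the free Schroedinger evolution on the torus\<close>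

definition japanese_bracket :: "int \<Rightarrow> real" where
  "japanese_bracket n = (1 + \<bar>real_of_int n\<bar>\<^sup>2) powr (1 / 2)"

text \<open>The sum over all integers is the limit of the symmetric partial sums. It must not be
  read as an unconditional (absolutely convergent) sum: for the coefficients
  \<open>\<langle>n\<rangle> powr -(1/2 + \<theta>) * g n\<close> with \<open>\<theta> \<le> 1/2\<close> absolute convergence fails almost surely,
  whereas for every \<open>\<theta> > 0\<close> the symmetric partial sums almost surely converge locally
  uniformly in time and space, to a limit that agrees with the one in \<open>L\<^sup>2\<close>.\<close>

definition fourier_series :: "(int \<Rightarrow> complex) \<Rightarrow> real \<Rightarrow> complex" where
  "fourier_series a x = lim (\<lambda>N::nat. \<Sum>n = - int N..int N. a n * cis (real_of_int n * x))"

text \<open>The propagator \<open>exp (i t \<Delta>)\<close> is the Fourier multiplier \<open>exp (- i t n\<^sup>2)\<close>; a function on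
  the torus is given here by its sequence \<open>a\<close> of Fourier coefficients.\<close>

definition free_evolution :: "(int \<Rightarrow> complex) \<Rightarrow> real \<Rightarrow> real \<Rightarrow> complex" where
  "free_evolution a t = fourier_series (\<lambda>n. cis (- t * (real_of_int n)\<^sup>2) * a n)"

text \<open>The torus is represented by the fundamental domain \<open>[0, 2\<pi>]\<close>, whose identified end
  points form a null set.\<close>

definition Linfty_norm_tx :: "real \<Rightarrow> (real \<Rightarrow> real \<Rightarrow> complex) \<Rightarrow> ereal" where
  "Linfty_norm_tx T u =
     esssup (restrict_space lborel ({0..T} \<times> {0..2 * pi})) (\<lambda>(t, x). ereal (norm (u t x)))"

end

theory Submission
  imports Defs "HOL-Real_Asymp.Real_Asymp"
begin

text \<open>
  All frequencies \<open>n\<^sup>2\<close> are integers, so the evolution is \<open>2\<pi>\<close>-periodic in time and the supremum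
  over any time interval is at most the supremum over one period. Write \<open>R = \<epsilon> powr (- 1 / 2)\<close>
  and split the solution into a symmetric partial sum and a tail.
  Partial sums inside the dyadic block \<open>2 ^ k \<le> \<bar>n\<bar> < 2 ^ (k + 1)\<close> have variance
  \<open>O(2 powr (- 2 * k * \<theta>))\<close>, so a union bound over all of them and over a grid in space-time whose
  size is exponential in \<open>k\<close> shows that the whole tail is uniformly at most \<open>\<eta> * R\<close> off an event of
  probability \<open>O(exp (- C * R\<^sup>2))\<close>, with \<open>C\<close> as large as we like if the partial sum is long enough.
  For the partial sum, a union bound over a fixed grid and finitely many directions in the complex
  plane gives the upper bound, and the Gaussian real part of its value at the origin the lower bound.
\<close>

section \<open>Gaussian tails\<close>

text \<open>Circular symmetry gives all projections \<open>X \<psi>\<close> the same second moment.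
  Two orthogonal ones share the total 1, so each has variance 1/2, which also rules out the
  degenerate Gaussian.\<close>

lemma (in prob_space) standard_complex_gaussian_Re_cis:
  assumes g: "standard_complex_gaussian M g"
  shows "distributed M lborel (\<lambda>\<omega>. Re (cis \<phi> * g \<omega>)) (normal_density 0 (sqrt (1/2)))"
proof -
  define X where "X \<psi> \<omega> = Re (cis \<psi> * g \<omega>)" for \<psi> \<omega>
  have meas [measurable]: "g \<in> borel_measurable M"
    and gauss: "\<And>a b. real_gaussian M (\<lambda>\<omega>. a * Re (g \<omega>) + b * Im (g \<omega>))"
    and circ: "\<And>\<psi>. distr M borel (\<lambda>\<omega>. cis \<psi> * g \<omega>) = distr M borel g"
    and mean: "integral\<^sup>L M g = 0" and var: "integral\<^sup>L M (\<lambda>\<omega>. (norm (g \<omega>))\<^sup>2) = 1"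
    using g unfolding standard_complex_gaussian_def complex_gaussian_def circularly_symmetric_def
    by auto
  \<comment> \<open>A non-integrable function would have Bochner integral 0, not 1.\<close>
  have int2: "integrable M (\<lambda>\<omega>. (norm (g \<omega>))\<^sup>2)"
    using var not_integrable_integral_eq by fastforce
  have "integrable M (\<lambda>\<omega>. norm (g \<omega>))"
    by (rule square_integrable_imp_integrable) (use int2 in auto)
  then have int1: "integrable M g" by (simp add: integrable_norm_iff)
  have XM [measurable]: "X \<psi> \<in> borel_measurable M" for \<psi> unfolding X_def by measurable
  have X_le: "(X \<psi> \<omega>)\<^sup>2 \<le> (norm (g \<omega>))\<^sup>2" for \<psi> \<omega>
  proof -
    have "\<bar>X \<psi> \<omega>\<bar> \<le> norm (g \<omega>)"
      unfolding X_def using abs_Re_le_cmod[of "cis \<psi> * g \<omega>"] by (simp add: norm_mult)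
    then show ?thesis by (metis abs_le_square_iff abs_norm_cancel)
  qed
  have X2int: "integrable M (\<lambda>\<omega>. (X \<psi> \<omega>)\<^sup>2)" for \<psi>
    by (rule Bochner_Integration.integrable_bound[OF int2]) (use X_le in auto)
  have Xmean: "integral\<^sup>L M (X \<psi>) = 0" for \<psi>
  proof -
    have "integral\<^sup>L M (X \<psi>) = Re (integral\<^sup>L M (\<lambda>\<omega>. cis \<psi> * g \<omega>))"
      unfolding X_def by (rule integral_Re) (use int1 in simp)
    also have "\<dots> = 0" using mean by simp
    finally show ?thesis .
  qed
  have X2eq: "integral\<^sup>L M (\<lambda>\<omega>. (X \<psi> \<omega>)\<^sup>2) = integral\<^sup>L M (\<lambda>\<omega>. (Re (g \<omega>))\<^sup>2)" for \<psi>
  proof -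
    have "integral\<^sup>L M (\<lambda>\<omega>. (X \<psi> \<omega>)\<^sup>2)
        = integral\<^sup>L (distr M borel (\<lambda>\<omega>. cis \<psi> * g \<omega>)) (\<lambda>z. (Re z)\<^sup>2)"
      unfolding X_def by (subst integral_distr) auto
    also have "\<dots> = integral\<^sup>L (distr M borel g) (\<lambda>z. (Re z)\<^sup>2)" by (simp only: circ)
    also have "\<dots> = integral\<^sup>L M (\<lambda>\<omega>. (Re (g \<omega>))\<^sup>2)" by (subst integral_distr) auto
    finally show ?thesis .
  qed
  have "1 = integral\<^sup>L M (\<lambda>\<omega>. (X 0 \<omega>)\<^sup>2 + (X (pi/2) \<omega>)\<^sup>2)"
    unfolding var[symmetric] X_def by (simp add: cmod_power2)
  also have "\<dots> = integral\<^sup>L M (\<lambda>\<omega>. (X 0 \<omega>)\<^sup>2) + integral\<^sup>L M (\<lambda>\<omega>. (X (pi/2) \<omega>)\<^sup>2)"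
    by (rule Bochner_Integration.integral_add[OF X2int X2int])
  also have "\<dots> = 2 * integral\<^sup>L M (\<lambda>\<omega>. (X \<phi> \<omega>)\<^sup>2)" by (simp add: X2eq)
  finally have half: "integral\<^sup>L M (\<lambda>\<omega>. (X \<phi> \<omega>)\<^sup>2) = 1/2" by simp
  have "real_gaussian M (X \<phi>)"
    using gauss[of "cos \<phi>" "- sin \<phi>"] unfolding X_def by simp
  then consider \<mu> \<sigma> where "\<sigma> > 0" "distributed M lborel (X \<phi>) (\<lambda>x. ennreal (normal_density \<mu> \<sigma> x))"
    | \<mu> where "AE \<omega> in M. X \<phi> \<omega> = \<mu>"
    unfolding real_gaussian_def by blast
  then show ?thesis
  proof cases
    case 1
    have "\<mu> = 0" using normal_distributed_expectation[OF 1] Xmean by simp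
    moreover have "\<sigma>\<^sup>2 = 1/2" using normal_distributed_variance[OF 1] Xmean half by simp
    then have "\<sigma> = sqrt (1/2)" using 1(1) by (metis less_eq_real_def real_sqrt_unique)
    ultimately show ?thesis using 1 unfolding X_def by simp
  next
    \<comment> \<open>A constant would have to equal its mean 0, contradicting the second moment
      1/2.\<close>
    case 2
    have "integral\<^sup>L M (X \<phi>) = integral\<^sup>L M (\<lambda>_. \<mu>)"
      by (rule integral_cong_AE) (use 2 in auto)
    then have "\<mu> = 0" using Xmean by (simp add: prob_space)
    have "integral\<^sup>L M (\<lambda>\<omega>. (X \<phi> \<omega>)\<^sup>2) = integral\<^sup>L M (\<lambda>_. 0::real)"
      by (rule integral_cong_AE) (use 2 \<open>\<mu> = 0\<close> in auto)
    then show ?thesis using half by simp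
  qed
qed

text \<open>For x > r >= 0 one has x^2 >= r^2 + (x - r)^2. So the density is at most the claimed
  bound times the density centred at r, whose integral is 1.\<close>

lemma (in prob_space) normal_tail_le:
  assumes X: "distributed M lborel X (normal_density 0 \<sigma>)" and r: "r \<ge> 0" and s: "\<sigma> > 0"
  shows "prob {\<omega> \<in> space M. X \<omega> > r} \<le> exp (- r\<^sup>2 / (2 * \<sigma>\<^sup>2))"
proof -
  have "emeasure M {\<omega> \<in> space M. X \<omega> > r} = emeasure M (X -` {r<..} \<inter> space M)"
    by (rule arg_cong[where f="emeasure M"]) auto
  also have "\<dots> = (\<integral>\<^sup>+x. ennreal (normal_density 0 \<sigma> x) * indicator {r<..} x \<partial>lborel)"
    by (rule distributed_emeasure[OF X]) simp
  also have "\<dots> \<le> (\<integral>\<^sup>+x. ennreal (exp (- r\<^sup>2 / (2 * \<sigma>\<^sup>2)) * normal_density r \<sigma> x) \<partial>lborel)"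
  proof (rule nn_integral_mono)
    fix x
    have "normal_density 0 \<sigma> x \<le> exp (- r\<^sup>2 / (2 * \<sigma>\<^sup>2)) * normal_density r \<sigma> x" if "x > r"
    proof -
      have "r * (x - r) \<ge> 0" using r that by simp
      then have "x\<^sup>2 \<ge> r\<^sup>2 + (x - r)\<^sup>2" by (simp add: power2_eq_square algebra_simps)
      then have "- x\<^sup>2 / (2 * \<sigma>\<^sup>2) \<le> - (r\<^sup>2 + (x - r)\<^sup>2) / (2 * \<sigma>\<^sup>2)"
        by (intro divide_right_mono) auto
      also have "\<dots> = - r\<^sup>2 / (2 * \<sigma>\<^sup>2) + - (x - r)\<^sup>2 / (2 * \<sigma>\<^sup>2)"
        by (simp add: add_divide_distrib diff_divide_distrib)
      finally have "exp (- x\<^sup>2 / (2 * \<sigma>\<^sup>2)) \<le> exp (- r\<^sup>2 / (2 * \<sigma>\<^sup>2)) * exp (- (x - r)\<^sup>2 / (2 * \<sigma>\<^sup>2))"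
        by (subst exp_add[symmetric]) (rule iffD2[OF exp_le_cancel_iff])
      then have "1 / sqrt (2 * pi * \<sigma>\<^sup>2) * exp (- x\<^sup>2 / (2 * \<sigma>\<^sup>2))
          \<le> 1 / sqrt (2 * pi * \<sigma>\<^sup>2) * (exp (- r\<^sup>2 / (2 * \<sigma>\<^sup>2)) * exp (- (x - r)\<^sup>2 / (2 * \<sigma>\<^sup>2)))"
        by (intro mult_left_mono) auto
      then show ?thesis unfolding normal_density_def by (simp add: mult.left_commute)
    qed
    then show "ennreal (normal_density 0 \<sigma> x) * indicator {r<..} x
        \<le> ennreal (exp (- r\<^sup>2 / (2 * \<sigma>\<^sup>2)) * normal_density r \<sigma> x)"
      by (auto intro!: ennreal_leI split: split_indicator)
  qed
  also have "\<dots> = ennreal (\<integral>x. exp (- r\<^sup>2 / (2 * \<sigma>\<^sup>2)) * normal_density r \<sigma> x \<partial>lborel)"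
    by (rule nn_integral_eq_integral) (use s in auto)
  also have "\<dots> = ennreal (exp (- r\<^sup>2 / (2 * \<sigma>\<^sup>2)))" using s by simp
  finally show ?thesis by (simp add: emeasure_eq_measure)
qed

text \<open>On the unit interval \<open>{r<..r+1}\<close> the density is at least its value at r +
  1. Replacing r by r + 1 does not affect the exponential rate for large r.\<close>

lemma (in prob_space) normal_tail_ge:
  assumes X: "distributed M lborel X (normal_density 0 \<sigma>)" and r: "r \<ge> 0" and s: "\<sigma> > 0"
  shows "prob {\<omega> \<in> space M. X \<omega> > r} \<ge> 1 / sqrt (2 * pi * \<sigma>\<^sup>2) * exp (- (r + 1)\<^sup>2 / (2 * \<sigma>\<^sup>2))"
proof -
  let ?c = "1 / sqrt (2 * pi * \<sigma>\<^sup>2) * exp (- (r + 1)\<^sup>2 / (2 * \<sigma>\<^sup>2))"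
  have "ennreal ?c = ennreal ?c * emeasure lborel {r<..r+1}" by simp
  also have "\<dots> = (\<integral>\<^sup>+x. ennreal ?c * indicator {r<..r+1} x \<partial>lborel)"
    by (rule nn_integral_cmult_indicator[symmetric]) simp
  also have "\<dots> \<le> (\<integral>\<^sup>+x. ennreal (normal_density 0 \<sigma> x) * indicator {r<..} x \<partial>lborel)"
  proof (rule nn_integral_mono)
    fix x
    have "?c \<le> normal_density 0 \<sigma> x" if "x > r" "x \<le> r + 1"
    proof -
      have "x\<^sup>2 \<le> (r + 1)\<^sup>2" using r that by (intro power_mono) auto
      then have "- (r + 1)\<^sup>2 / (2 * \<sigma>\<^sup>2) \<le> - x\<^sup>2 / (2 * \<sigma>\<^sup>2)"
        by (intro divide_right_mono) auto
      then show ?thesis unfolding normal_density_def by (intro mult_left_mono) auto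
    qed
    then show "ennreal ?c * indicator {r<..r+1} x
        \<le> ennreal (normal_density 0 \<sigma> x) * indicator {r<..} x"
      by (auto intro!: ennreal_leI split: split_indicator)
  qed
  also have "\<dots> = emeasure M (X -` {r<..} \<inter> space M)"
    by (rule distributed_emeasure[OF X, symmetric]) simp
  also have "\<dots> = emeasure M {\<omega> \<in> space M. X \<omega> > r}"
    by (rule arg_cong[where f="emeasure M"]) auto
  finally show ?thesis by (simp add: emeasure_eq_measure)
qed

text \<open>Rotations preserve the law of \<open>g i\<close>, so the real part is a sum of
  independent centred normals of variances (c i)^2 / 2. The law is thus the same at every point of
  space-time and in every direction.\<close>

lemma (in prob_space) normal_sum_complex_gaussian:
  fixes g :: "'i \<Rightarrow> 'a \<Rightarrow> complex"
  assumes ind: "indep_vars (\<lambda>_. borel) g I" and g: "\<And>i. i \<in> I \<Longrightarrow> standard_complex_gaussian M (g i)"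
    and I: "finite I" "I \<noteq> {}" and c: "\<And>i. i \<in> I \<Longrightarrow> c i > 0"
  shows "distributed M lborel
           (\<lambda>\<omega>. Re (cis \<beta> * (\<Sum>i\<in>I. cis (\<phi> i) * (of_real (c i) * g i \<omega>))))
           (normal_density 0 (sqrt ((\<Sum>i\<in>I. (c i)\<^sup>2) / 2)))"
proof -
  define X where "X i \<omega> = c i * Re (cis (\<beta> + \<phi> i) * g i \<omega>)" for i \<omega>
  have "distributed M lborel (\<lambda>\<omega>. \<Sum>i\<in>I. X i \<omega>)
      (normal_density (\<Sum>i\<in>I. 0) (sqrt (\<Sum>i\<in>I. (c i * sqrt (1/2))\<^sup>2)))"
  proof (rule sum_indep_normal)
    show "indep_vars (\<lambda>i. borel) X I"
      unfolding X_def
      by (rule indep_vars_compose2[OF ind, where Y="\<lambda>i z. c i * Re (cis (\<beta> + \<phi> i) * z)"]) simp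
    show "distributed M lborel (X i) (\<lambda>x. ennreal (normal_density 0 (c i * sqrt (1/2)) x))"
      if "i \<in> I" for i
      using normal_density_affine[OF standard_complex_gaussian_Re_cis[OF g[OF that], of "\<beta> + \<phi> i"],
          of "c i" 0] c[OF that] by (simp add: X_def[abs_def])
  qed (use I c in auto)
  moreover have "(\<Sum>i\<in>I. X i \<omega>) = Re (cis \<beta> * (\<Sum>i\<in>I. cis (\<phi> i) * (of_real (c i) * g i \<omega>)))" for \<omega>
    unfolding X_def sum_distrib_left Re_sum
    by (rule sum.cong) (auto simp: cis_mult[symmetric] algebra_simps)
  moreover have "(\<Sum>i\<in>I. (c i * sqrt (1/2))\<^sup>2) = (\<Sum>i\<in>I. (c i)\<^sup>2) / 2"
    by (simp add: power_mult_distrib power_divide sum_divide_distrib)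
  ultimately show ?thesis by simp
qed

section \<open>Trigonometric sums on a grid and dyadic limits\<close>

text \<open>Round x L / (2 pi) to the nearest integer and divide that by L: the remainder is the
  grid index, the quotient counts full periods.\<close>

lemma torus_grid_approx:
  fixes x :: real and L :: nat
  assumes "L > 0"
  obtains j d q where "j < L" "x = 2 * pi * real j / real L + d + 2 * pi * real_of_int q" "\<bar>d\<bar> \<le> pi / L"
proof -
  define y where "y = x * L / (2 * pi)"
  define m where "m = round y"
  define d where "d = 2 * pi / L * (y - m)"
  have "\<bar>real_of_int m - y\<bar> \<le> 1/2"
    unfolding m_def by (rule of_int_round_abs_le)
  then have "2 * pi / L * \<bar>y - m\<bar> \<le> 2 * pi / L * (1/2)"
    by (intro mult_left_mono) (auto simp: abs_minus_commute)
  then have d: "\<bar>d\<bar> \<le> pi / L"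
    unfolding d_def abs_mult by simp
  have "m = int L * (m div int L) + m mod int L" by simp
  then have m: "real_of_int m = real L * real_of_int (m div int L) + real_of_int (m mod int L)"
    by (metis of_int_add of_int_mult of_int_of_nat_eq)
  have j: "real (nat (m mod int L)) = real_of_int (m mod int L)"
    using assms by (simp add: of_nat_nat)
  have "x = 2 * pi / L * y" unfolding y_def using assms by simp
  also have "\<dots> = 2 * pi / L * m + d" unfolding d_def by (simp only: right_diff_distrib)
  also have "2 * pi / L * m = 2 * pi * real (nat (m mod int L)) / L + 2 * pi * real_of_int (m div int L)"
    unfolding m j using assms by (simp add: field_simps)
  finally have "x = 2 * pi * real (nat (m mod int L)) / L + d + 2 * pi * real_of_int (m div int L)"
    by simp
  moreover have "nat (m mod int L) < L" using assms by (simp add: nat_less_iff)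
  ultimately show ?thesis using d that by blast
qed

lemma cis_add_2pi_int: "cis (x + 2 * pi * real_of_int q) = cis x"
  using cis_multiple_2pi[of "real_of_int q"] by (simp add: cis_mult[symmetric])

text \<open>Some vertex of the regular J-gon lies within angle pi / J of - Arg z. Finitely many real
  parts therefore control the norm up to a factor that tends to 1 as J grows.\<close>

lemma polygon_direction:
  fixes z :: complex and J :: nat
  assumes "J > 0"
  obtains j where "j < J" "norm z * cos (pi / J) \<le> Re (cis (2 * pi * real j / J) * z)"
proof -
  obtain j d q where j: "j < J" and eq: "- Arg z = 2 * pi * real j / J + d + 2 * pi * real_of_int q"
    and d: "\<bar>d\<bar> \<le> pi / J"
    using torus_grid_approx[OF assms] by metis
  have "cis (2 * pi * real j / J) * cis (Arg z) = cis (- d + 2 * pi * real_of_int (- q))"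
    unfolding cis_mult using eq by (intro arg_cong[where f=cis]) simp
  also have "\<dots> = cis (- d)" by (rule cis_add_2pi_int)
  finally have *: "cis (2 * pi * real j / J) * cis (Arg z) = cis (- d)" .
  have "z = of_real (norm z) * cis (Arg z)"
    using rcis_cmod_Arg[of z] by (simp add: rcis_def)
  then have "cis (2 * pi * real j / J) * z = of_real (norm z) * cis (- d)"
    using * by (metis mult.left_commute)
  then have "Re (cis (2 * pi * real j / J) * z) = norm z * cos \<bar>d\<bar>" by simp
  moreover have "cos (pi / J) \<le> cos \<bar>d\<bar>"
    by (rule cos_monotone_0_pi_le) (use d assms in \<open>auto simp: divide_le_eq\<close>)
  ultimately show ?thesis using that[OF j] by (simp add: mult_left_mono)
qed

section \<open>Finite trigonometric sums in space-time\<close>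

lemma norm_cis_diff_le: "norm (cis u - cis v) \<le> \<bar>u - v\<bar>"
proof -
  have "(norm (cis u - cis v))\<^sup>2 = (cos u - cos v)\<^sup>2 + (sin u - sin v)\<^sup>2"
    by (simp add: cmod_power2)
  also have "\<dots> = 2 - 2 * cos (u - v)"
    using sin_cos_squared_add[of u] sin_cos_squared_add[of v]
    by (simp add: cos_diff power2_eq_square algebra_simps)
  also have "\<dots> = (2 * sin ((u - v) / 2))\<^sup>2"
  proof -
    have "2 * ((u - v) / 2) = u - v" by simp
    then have "cos (u - v) = 1 - 2 * (sin ((u - v) / 2))\<^sup>2"
      using cos_double_sin[of "(u - v) / 2"] by metis
    then show ?thesis by (simp add: power_mult_distrib)
  qed
  also have "\<dots> \<le> \<bar>u - v\<bar>\<^sup>2"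
    using abs_sin_x_le_abs_x[of "(u - v) / 2"]
    by (intro power2_le_iff_abs_le[THEN iffD2]) (auto simp: abs_mult)
  finally show ?thesis by (rule power2_le_imp_le) simp
qed

definition wave_sum :: "int set \<Rightarrow> (int \<Rightarrow> complex) \<Rightarrow> real \<Rightarrow> real \<Rightarrow> complex" where
  "wave_sum I a t x = (\<Sum>n\<in>I. cis (real_of_int n * x - t * (real_of_int n)\<^sup>2) * a n)"

text \<open>The phase of mode n changes by 2 pi times the integer n q - p n^2.\<close>

lemma wave_sum_periodic:
  "wave_sum I a (t + 2 * pi * real_of_int p) (x + 2 * pi * real_of_int q) = wave_sum I a t x"
proof -
  have "cis (real_of_int n * (x + 2 * pi * real_of_int q) - (t + 2 * pi * real_of_int p) * (real_of_int n)\<^sup>2)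
      = cis (real_of_int n * x - t * (real_of_int n)\<^sup>2)" for n
    using cis_add_2pi_int[of "real_of_int n * x - t * (real_of_int n)\<^sup>2" "n * q - p * n\<^sup>2"]
    by (simp add: algebra_simps)
  then show ?thesis unfolding wave_sum_def by simp
qed

text \<open>Moving to the nearest grid point, modulo periods, changes the phase of each mode by at
  most (N + N^2) pi / L; the triangle inequality adds this up over the modes.\<close>

lemma wave_sum_grid:
  fixes L :: nat
  assumes L: "L > 0" and N: "\<And>n. n \<in> I \<Longrightarrow> \<bar>real_of_int n\<bar> \<le> N"
    and B: "\<And>n. n \<in> I \<Longrightarrow> norm (a n) \<le> B"
    and A: "\<And>i j. i < L \<Longrightarrow> j < L \<Longrightarrow> norm (wave_sum I a (2 * pi * real i / L) (2 * pi * real j / L)) \<le> A"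
  shows "norm (wave_sum I a t x) \<le> A + card I * (B * ((N + N\<^sup>2) * (pi / L)))"
proof -
  obtain i d p where i: "i < L" "t = 2 * pi * real i / L + d + 2 * pi * real_of_int p" "\<bar>d\<bar> \<le> pi / L"
    using torus_grid_approx[OF L] by metis
  obtain j e q where j: "j < L" "x = 2 * pi * real j / L + e + 2 * pi * real_of_int q" "\<bar>e\<bar> \<le> pi / L"
    using torus_grid_approx[OF L] by metis
  let ?t = "2 * pi * real i / L" and ?x = "2 * pi * real j / L"
  have eq: "wave_sum I a t x = wave_sum I a (?t + d) (?x + e)"
    unfolding i(2) j(2) by (rule wave_sum_periodic)
  have "norm (wave_sum I a (?t + d) (?x + e) - wave_sum I a ?t ?x)
      = norm (\<Sum>n\<in>I. (cis (real_of_int n * (?x + e) - (?t + d) * (real_of_int n)\<^sup>2)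
            - cis (real_of_int n * ?x - ?t * (real_of_int n)\<^sup>2)) * a n)"
    unfolding wave_sum_def by (simp add: sum_subtractf[symmetric] algebra_simps)
  also have "\<dots> \<le> (\<Sum>n\<in>I. B * ((N + N\<^sup>2) * (pi / L)))"
  proof (rule sum_norm_le)
    fix n assume n: "n \<in> I"
    have "norm (cis (real_of_int n * (?x + e) - (?t + d) * (real_of_int n)\<^sup>2)
            - cis (real_of_int n * ?x - ?t * (real_of_int n)\<^sup>2))
        \<le> \<bar>real_of_int n * e - d * (real_of_int n)\<^sup>2\<bar>"
      by (rule order_trans[OF norm_cis_diff_le]) (simp add: algebra_simps)
    also have "\<dots> \<le> \<bar>real_of_int n\<bar> * \<bar>e\<bar> + \<bar>real_of_int n\<bar>\<^sup>2 * \<bar>d\<bar>"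
      using abs_triangle_ineq4[of "real_of_int n * e" "d * (real_of_int n)\<^sup>2"]
      by (simp add: abs_mult mult.commute)
    also have "\<dots> \<le> N * (pi / L) + N\<^sup>2 * (pi / L)"
      using N[OF n] i(3) j(3) by (intro add_mono mult_mono power_mono) auto
    finally have "norm (cis (real_of_int n * (?x + e) - (?t + d) * (real_of_int n)\<^sup>2)
            - cis (real_of_int n * ?x - ?t * (real_of_int n)\<^sup>2)) * norm (a n)
        \<le> (N * (pi / L) + N\<^sup>2 * (pi / L)) * B"
      using B[OF n] order_trans[OF abs_ge_zero N[OF n]] by (intro mult_mono) auto
    then show "norm ((cis (real_of_int n * (?x + e) - (?t + d) * (real_of_int n)\<^sup>2)
            - cis (real_of_int n * ?x - ?t * (real_of_int n)\<^sup>2)) * a n) \<le> B * ((N + N\<^sup>2) * (pi / L))"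
      by (simp only: norm_mult) (simp only: ring_distribs ac_simps)
  qed
  finally have "norm (wave_sum I a (?t + d) (?x + e) - wave_sum I a ?t ?x)
      \<le> card I * (B * ((N + N\<^sup>2) * (pi / L)))" by simp
  then show ?thesis unfolding eq
    using A[OF i(1) j(1)] norm_triangle_sub[of "wave_sum I a (?t + d) (?x + e)" "wave_sum I a ?t ?x"]
    by linarith
qed

lemma continuous_on_wave_sum: "continuous_on UNIV (\<lambda>(t, x). wave_sum I a t x)"
  unfolding wave_sum_def case_prod_beta
  by (intro continuous_intros continuous_on_cis)

lemma free_evolution_eq_lim:
  "free_evolution a t x = lim (\<lambda>N. wave_sum {- int N..int N} a t x)"
  unfolding free_evolution_def fourier_series_def wave_sum_def
  by (simp add: cis_mult[symmetric] diff_conv_add_uminus algebra_simps del: add_uminus_conv_diff)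

text \<open>The values at the block ends have summable increments and converge. Since the hypothesis
  covers every m inside a block, the full sequence converges too, so \<open>lim s\<close> is a
  genuine limit and not an unspecified value.\<close>

lemma dyadic_limit_bound:
  fixes s :: "nat \<Rightarrow> 'b::banach"
  assumes r: "summable r" "\<And>k. r k \<ge> 0"
    and s: "\<And>k m. k \<ge> K \<Longrightarrow> 2 ^ k \<le> m \<Longrightarrow> m < 2 ^ (k + 1) \<Longrightarrow> norm (s m - s (2 ^ k - 1)) \<le> r k"
  shows "norm (lim s - s (2 ^ K - 1)) \<le> suminf r"
proof -
  define b where "b i = s (2 ^ (i + K + 1) - 1) - s (2 ^ (i + K) - 1)" for i
  have rK: "summable (\<lambda>i. r (i + K))" using r by (simp add: summable_iff_shift)
  have rK_le: "(\<Sum>i. r (i + K)) \<le> suminf r"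
    using suminf_split_initial_segment[OF r(1), of K] sum_nonneg[of "{..<K}" r] r(2) by simp
  \<comment> \<open>The index 2^(i + K + 1) - 1 is the last one of block i + K.\<close>
  have bn: "norm (b i) \<le> r (i + K)" for i
  proof -
    have "(2::nat) ^ (i + K + 1) = 2 * 2 ^ (i + K)" by simp
    moreover have "(2::nat) ^ (i + K) \<ge> 1" by simp
    ultimately show ?thesis unfolding b_def by (intro s) linarith+
  qed
  have nb: "summable (\<lambda>i. norm (b i))"
    by (rule summable_comparison_test'[OF rK, of 0]) (use bn in simp)
  then have sb: "summable b" by (rule summable_norm_cancel)
  have tele: "(\<Sum>i<n. b i) = s (2 ^ (n + K) - 1) - s (2 ^ K - 1)" for n
    unfolding b_def using sum_lessThan_telescope[of "\<lambda>n. s (2 ^ (n + K) - 1)" n] by simp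
  define l where "l = s (2 ^ K - 1) + suminf b"
  have "(\<lambda>n. \<Sum>i<n. b i) \<longlonglongrightarrow> suminf b" by (rule summable_LIMSEQ[OF sb])
  then have "(\<lambda>n. s (2 ^ K - 1) + (\<Sum>i<n. b i)) \<longlonglongrightarrow> l"
    unfolding l_def by (intro tendsto_intros)
  then have "(\<lambda>n. s (2 ^ (n + K) - 1)) \<longlonglongrightarrow> l" unfolding tele by simp
  then have dy: "(\<lambda>n. s (2 ^ n - 1)) \<longlonglongrightarrow> l" by (rule LIMSEQ_offset)
  \<comment> \<open>\<open>floor_log m\<close> is the number of the block containing m; the two
    terms bound the distance from \<open>s m\<close> to \<open>l\<close> through the value just
    before that block.\<close>
  have "(\<lambda>m. norm (s (2 ^ floor_log m - 1) - l) + r (floor_log m)) \<longlonglongrightarrow> 0 + 0"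
  proof (rule tendsto_add)
    have fl: "filterlim floor_log at_top sequentially"
      unfolding filterlim_at_top
    proof
      fix Z :: nat
      show "\<forall>\<^sub>F x in sequentially. Z \<le> floor_log x"
        using eventually_ge_at_top[of "2 ^ Z"]
      proof eventually_elim
        case (elim m)
        then show ?case using floor_log_le_iff[OF elim] by simp
      qed
    qed
    show "(\<lambda>m. norm (s (2 ^ floor_log m - 1) - l)) \<longlonglongrightarrow> 0"
      using filterlim_compose[OF dy fl] by (simp add: tendsto_norm_zero_iff LIM_zero_iff)
    show "(\<lambda>m. r (floor_log m)) \<longlonglongrightarrow> 0"
      using filterlim_compose[OF summable_LIMSEQ_zero[OF r(1)] fl] .
  qed
  then have bound0: "(\<lambda>m. norm (s (2 ^ floor_log m - 1) - l) + r (floor_log m)) \<longlonglongrightarrow> 0"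
    by simp
  have "(\<lambda>m. s m - l) \<longlonglongrightarrow> 0"
  proof (rule Lim_null_comparison[OF _ bound0])
    show "\<forall>\<^sub>F m in sequentially. norm (s m - l) \<le> norm (s (2 ^ floor_log m - 1) - l) + r (floor_log m)"
      using eventually_ge_at_top[of "2 ^ K"]
    proof eventually_elim
      case (elim m)
      have "m > 0" using elim by (rule order_less_le_trans[rotated]) simp
      have "norm (s m - s (2 ^ floor_log m - 1)) \<le> r (floor_log m)"
        using floor_log_le_iff[OF elim] floor_log_exp2_le[OF \<open>m > 0\<close>] floor_log_exp2_gt[of m]
        by (intro s) auto
      moreover have "norm (s m - l) \<le> norm (s m - s (2 ^ floor_log m - 1)) + norm (s (2 ^ floor_log m - 1) - l)"
        using norm_triangle_ineq[of "s m - s (2 ^ floor_log m - 1)" "s (2 ^ floor_log m - 1) - l"] by simp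
      ultimately show ?case by simp
    qed
  qed
  then have "lim s = l" by (intro limI) (simp add: LIM_zero_iff)
  moreover have "norm (suminf b) \<le> (\<Sum>i. r (i + K))"
    using summable_norm[OF nb] suminf_le[OF bn nb rK] by linarith
  ultimately show ?thesis unfolding l_def using rK_le by simp
qed

text \<open>The exponential series gives exp (- y) <= p! / y^p for y > 0. With p so large that Q^p >
  2 M, a geometric series of ratio 1/2 dominates.\<close>

lemma summable_power_exp:
  fixes M a Q :: real
  assumes "M \<ge> 0" "a > 0" "Q > 1"
  shows "summable (\<lambda>k. M ^ k * exp (- (a * Q ^ k)))"
proof -
  obtain p where p: "2 * M < Q ^ p" using real_arch_pow[OF assms(3)] by blast
  show ?thesis
  proof (rule summable_comparison_test')
    show "summable (\<lambda>k. (fact p / a ^ p) * (1/2) ^ k :: real)"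
      by (intro summable_mult summable_geometric) simp
    fix k :: nat
    have Qk: "Q ^ k > 0" using assms by simp
    have "(a * Q ^ k) ^ p / fact p \<le> exp (a * Q ^ k)"
    proof -
      have "(\<Sum>i\<in>{p}. inverse (fact i) *\<^sub>R (a * Q ^ k) ^ i) \<le> (\<Sum>i. inverse (fact i) *\<^sub>R (a * Q ^ k) ^ i)"
        by (rule sum_le_suminf[OF summable_exp_generic]) (use assms in auto)
      then show ?thesis unfolding exp_def by (simp add: field_simps)
    qed
    moreover have pos: "(a * Q ^ k) ^ p / fact p > 0" using assms by simp
    ultimately have "inverse (exp (a * Q ^ k)) \<le> inverse ((a * Q ^ k) ^ p / fact p)"
      by (intro le_imp_inverse_le) auto
    then have "exp (- (a * Q ^ k)) \<le> fact p / (a ^ p * (Q ^ p) ^ k)"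
      by (simp add: exp_minus power_mult_distrib power_mult[symmetric] mult.commute)
    then have "M ^ k * exp (- (a * Q ^ k)) \<le> M ^ k * (fact p / (a ^ p * (Q ^ p) ^ k))"
      using assms by (intro mult_left_mono) auto
    also have "\<dots> = fact p / a ^ p * (M / Q ^ p) ^ k" by (simp add: power_divide)
    also have "\<dots> \<le> fact p / a ^ p * (1/2) ^ k"
      using p assms by (intro mult_left_mono power_mono) (auto simp: divide_le_eq)
    finally show "norm (M ^ k * exp (- (a * Q ^ k))) \<le> (fact p / a ^ p) * (1/2) ^ k"
      using assms by simp
  qed
qed

section \<open>Essential suprema and logarithmic limits\<close>

text \<open>The measure of a superlevel set serves three ends: it depends measurably on the random
  parameter, its positivity provides a point for the upper bound, and a small box is enough for the
  lower bound.\<close>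

lemma esssup_gt_iff:
  fixes f :: "'a \<Rightarrow> 'b::{second_countable_topology, dense_linorder, linorder_topology, complete_linorder}"
  assumes f [measurable]: "f \<in> borel_measurable M"
  shows "esssup M f > z \<longleftrightarrow> emeasure M {x \<in> space M. f x > z} > 0"
proof
  assume "esssup M f > z"
  then show "emeasure M {x \<in> space M. f x > z} > 0" by (rule esssup_pos_measure[OF f])
next
  assume pos: "emeasure M {x \<in> space M. f x > z} > 0"
  show "esssup M f > z"
  proof (rule ccontr)
    assume "\<not> esssup M f > z"
    then have "AE x in M. f x \<le> z"
      using esssup_AE[of f M] by (auto elim!: eventually_mono)
    then have "emeasure M {x \<in> space M. \<not> f x \<le> z} = 0"
      by (subst (asm) AE_iff_measurable[OF _ refl]) auto
    then show False using pos by (simp add: not_le)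
  qed
qed

lemma Linfty_norm_tx_gt_iff:
  assumes u: "(\<lambda>p. u (fst p) (snd p)) \<in> borel_measurable borel"
  shows "Linfty_norm_tx T u > ereal z \<longleftrightarrow>
    emeasure lborel {p. p \<in> {0..T} \<times> {0..2 * pi} \<and> norm (u (fst p) (snd p)) > z} > 0"
proof -
  let ?X = "{0..T} \<times> {0..2 * pi}"
  have X: "?X \<in> sets borel" by (intro borel_closed closed_Times closed_atLeastAtMost)
  have f: "(\<lambda>(t, x). ereal (norm (u t x))) \<in> borel_measurable (restrict_space lborel ?X)"
    using u unfolding case_prod_beta by (intro measurable_restrict_space1) simp
  have "{p \<in> space (restrict_space lborel ?X). (\<lambda>(t, x). ereal (norm (u t x))) p > ereal z}
      = {p. p \<in> ?X \<and> norm (u (fst p) (snd p)) > z}"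
    by (auto simp: space_restrict_space)
  then show ?thesis
    unfolding Linfty_norm_tx_def esssup_gt_iff[OF f] using X
    by (subst emeasure_restrict_space) auto
qed

text \<open>A prefactor D contributes only \<epsilon> * ln D, which vanishes in the limit, and the
  rates can be taken arbitrarily close to W on either side.\<close>

lemma tendsto_scaled_ln:
  fixes F :: "real \<Rightarrow> real"
  assumes upper: "\<And>w. w < W \<Longrightarrow> \<exists>D>0. \<forall>\<^sub>F \<epsilon> in at_right 0. F \<epsilon> \<le> D * exp (- (w / \<epsilon>))"
    and lower: "\<And>v. v > W \<Longrightarrow> \<exists>D>0. \<forall>\<^sub>F \<epsilon> in at_right 0. F \<epsilon> \<ge> D * exp (- (v / \<epsilon>))"
  shows "((\<lambda>\<epsilon>. \<epsilon> * ln (F \<epsilon>)) \<longlongrightarrow> - W) (at_right 0)"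
proof -
  have ln_eq: "\<epsilon> * ln (D * exp (- (y / \<epsilon>))) = \<epsilon> * ln D - y" if "\<epsilon> > 0" "D > 0" for \<epsilon> D y :: real
    using that by (simp add: ln_mult algebra_simps)
  have lim: "((\<lambda>\<epsilon>. \<epsilon> * ln D - y) \<longlongrightarrow> - y) (at_right 0)" for D y :: real
    by real_asymp
  have pos: "\<forall>\<^sub>F \<epsilon> in at_right 0. \<epsilon> > (0::real)" by (rule eventually_at_right_less)
  show ?thesis
  proof (rule order_tendstoI)
    fix b assume "b < - W"
    then obtain v where v: "W < v" "v < - b" using dense[of W "- b"] by auto
    obtain D where D: "D > 0" "\<forall>\<^sub>F \<epsilon> in at_right 0. F \<epsilon> \<ge> D * exp (- (v / \<epsilon>))"
      using lower[OF v(1)] by blast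
    have "\<forall>\<^sub>F \<epsilon> in at_right 0. b < \<epsilon> * ln D - v"
      by (rule order_tendstoD(1)[OF lim]) (use v in simp)
    with D(2) pos show "\<forall>\<^sub>F \<epsilon> in at_right 0. b < \<epsilon> * ln (F \<epsilon>)"
    proof eventually_elim
      case (elim \<epsilon>)
      have "ln (D * exp (- (v / \<epsilon>))) \<le> ln (F \<epsilon>)" using elim D(1) by (intro ln_mono) auto
      then have "\<epsilon> * ln (D * exp (- (v / \<epsilon>))) \<le> \<epsilon> * ln (F \<epsilon>)" using elim by (intro mult_left_mono) auto
      then show ?case using elim ln_eq[OF _ D(1)] by simp
    qed
  next
    fix b assume "b > - W"
    then obtain w where w: "- b < w" "w < W" using dense[of "- b" W] by auto
    obtain D where D: "D > 0" "\<forall>\<^sub>F \<epsilon> in at_right 0. F \<epsilon> \<le> D * exp (- (w / \<epsilon>))"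
      using upper[OF w(2)] by blast
    \<comment> \<open>The lower bound at rate W + 1 only ensures F \<epsilon> > 0, so that
      monotonicity of \<open>ln\<close> applies.\<close>
    obtain D' where D': "D' > 0" "\<forall>\<^sub>F \<epsilon> in at_right 0. F \<epsilon> \<ge> D' * exp (- ((W + 1) / \<epsilon>))"
      using lower[of "W + 1"] by auto
    have "\<forall>\<^sub>F \<epsilon> in at_right 0. b > \<epsilon> * ln D - w"
      by (rule order_tendstoD(2)[OF lim]) (use w in simp)
    with D(2) D'(2) pos show "\<forall>\<^sub>F \<epsilon> in at_right 0. b > \<epsilon> * ln (F \<epsilon>)"
    proof eventually_elim
      case (elim \<epsilon>)
      have "D' * exp (- ((W + 1) / \<epsilon>)) > 0" using D'(1) by simp
      then have "F \<epsilon> > 0" using elim by linarith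
      then have "ln (F \<epsilon>) \<le> ln (D * exp (- (w / \<epsilon>)))" using elim D(1) by (intro ln_mono) auto
      then have "\<epsilon> * ln (F \<epsilon>) \<le> \<epsilon> * ln (D * exp (- (w / \<epsilon>)))" using elim by (intro mult_left_mono) auto
      then show ?case using elim ln_eq[OF _ D(1)] by simp
    qed
  qed
qed

section \<open>The random Fourier series\<close>

locale gaussian_fourier_series = prob_space M
  for M :: "'w measure" +
  fixes g :: "int \<Rightarrow> 'w \<Rightarrow> complex" and c :: "int \<Rightarrow> real" and \<theta> :: real
  assumes theta_pos: "\<theta> > 0"
    and c_eq: "\<And>n. c n = japanese_bracket n powr (- (1 / 2 + \<theta>))"
    and indep: "indep_vars (\<lambda>_. borel) g UNIV"
    and gauss: "\<And>n. standard_complex_gaussian M (g n)"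
begin

abbreviation coeffs :: "'w \<Rightarrow> int \<Rightarrow> complex" where
  "coeffs \<omega> n \<equiv> complex_of_real (c n) * g n \<omega>"

lemma g_measurable [measurable]: "g n \<in> borel_measurable M"
  using gauss unfolding standard_complex_gaussian_def complex_gaussian_def by auto

lemma c_sq: "(c n)\<^sup>2 = (1 + (real_of_int n)\<^sup>2) powr (- (1 / 2 + \<theta>))"
proof -
  have "1 + (real_of_int n)\<^sup>2 > 0" by (rule add_pos_nonneg) auto
  then show ?thesis unfolding c_eq japanese_bracket_def
    by (simp add: powr_powr powr_power add_divide_distrib diff_divide_distrib)
qed

lemma c_pos: "c n > 0"
proof -
  have "1 + (real_of_int n)\<^sup>2 > 0" by (rule add_pos_nonneg) auto
  then show ?thesis unfolding c_eq japanese_bracket_def by simp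
qed

lemma c_sq_le: 
  assumes "0 < N" "N \<le> \<bar>real_of_int n\<bar>"
  shows "(c n)\<^sup>2 \<le> N powr (- (1 + 2 * \<theta>))"
proof -
  have "N\<^sup>2 \<le> 1 + (real_of_int n)\<^sup>2"
    using power_mono[OF assms(2), of 2] assms(1) by simp
  then have "(c n)\<^sup>2 \<le> (N\<^sup>2) powr (- (1 / 2 + \<theta>))"
    unfolding c_sq using assms theta_pos by (intro powr_mono2') auto
  also have "\<dots> = (N powr 2) powr (- (1 / 2 + \<theta>))" using assms by (simp add: powr_numeral)
  also have "\<dots> = N powr (- (1 + 2 * \<theta>))"
    unfolding powr_powr by (rule arg_cong[where f="\<lambda>x. N powr x"]) (simp add: field_simps)
  finally show ?thesis .
qed

lemma c_sq_le_1: "(c n)\<^sup>2 \<le> 1"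
  unfolding c_sq using theta_pos powr_mono2'[of "- (1/2 + \<theta>)" 1 "1 + (real_of_int n)\<^sup>2"] by simp

section \<open>Union bounds for finite random sums\<close>

text \<open>If the norm exceeds r, one of J projections exceeds r cos (pi / J), and each is a
  centred normal of variance at most V / 2. J = 4 suffices where constants do not matter; a large J
  gives the sharp rate.\<close>

lemma prob_complex_sum_le:
  fixes J :: nat
  assumes I: "finite I" "I \<noteq> {}" and V: "(\<Sum>n\<in>I. (c n)\<^sup>2) \<le> V" and J: "J \<ge> 3" and r: "r \<ge> 0"
  shows "prob {\<omega> \<in> space M. norm (\<Sum>n\<in>I. cis (\<phi> n) * coeffs \<omega> n) > r}
    \<le> J * exp (- (r * cos (pi / J))\<^sup>2 / V)"
proof -
  define Z where "Z \<omega> = (\<Sum>n\<in>I. cis (\<phi> n) * coeffs \<omega> n)" for \<omega>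
  define s where "s = (\<Sum>n\<in>I. (c n)\<^sup>2)"
  have s: "s > 0" unfolding s_def using I by (intro sum_pos) (use c_pos in \<open>auto simp: less_imp_neq[OF c_pos, symmetric]\<close>)
  have ZM [measurable]: "Z \<in> borel_measurable M" unfolding Z_def by measurable
  \<comment> \<open>J >= 3 puts pi / J below pi / 2.\<close>
  have cosp: "cos (pi / J) > 0" 
  proof (rule cos_gt_zero)
    show "0 < pi / J" using J by simp
    show "pi / J < pi / 2" by (rule divide_strict_left_mono) (use J in auto)
  qed
  define E where "E j = {\<omega> \<in> space M. Re (cis (2 * pi * real j / J) * Z \<omega>) > r * cos (pi / J)}" for j :: nat
  have EM [measurable]: "E j \<in> events" for j unfolding E_def by measurable
  have sub: "{\<omega> \<in> space M. norm (Z \<omega>) > r} \<subseteq> (\<Union>j\<in>{..<J}. E j)"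
  proof
    fix \<omega> assume w: "\<omega> \<in> {\<omega> \<in> space M. norm (Z \<omega>) > r}"
    obtain j where "j < J" "norm (Z \<omega>) * cos (pi / J) \<le> Re (cis (2 * pi * real j / J) * Z \<omega>)"
      using polygon_direction[of J] J by (metis not_gr_zero not_numeral_le_zero)
    moreover have "r * cos (pi / J) < norm (Z \<omega>) * cos (pi / J)" using w cosp by simp
    ultimately show "\<omega> \<in> (\<Union>j\<in>{..<J}. E j)" using w unfolding E_def by force
  qed
  have "prob {\<omega> \<in> space M. norm (Z \<omega>) > r} \<le> prob (\<Union>j\<in>{..<J}. E j)"
    by (rule finite_measure_mono[OF sub]) auto
  also have "\<dots> \<le> (\<Sum>j<J. prob (E j))"
    by (rule finite_measure_subadditive_finite) auto
  also have "\<dots> \<le> (\<Sum>j<J. exp (- (r * cos (pi / J))\<^sup>2 / V))"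
  proof (rule sum_mono)
    fix j
    have D: "distributed M lborel (\<lambda>\<omega>. Re (cis (2 * pi * real j / J) * Z \<omega>)) (normal_density 0 (sqrt (s / 2)))"
      unfolding Z_def s_def
      by (rule normal_sum_complex_gaussian[OF indep_vars_subset[OF indep] gauss I c_pos]) auto
    have "prob (E j) \<le> exp (- (r * cos (pi / J))\<^sup>2 / (2 * (sqrt (s / 2))\<^sup>2))"
      unfolding E_def by (rule normal_tail_le[OF D]) (use s r cosp in auto)
    also have "2 * (sqrt (s / 2))\<^sup>2 = s" using s by simp
    also have "exp (- (r * cos (pi / J))\<^sup>2 / s) \<le> exp (- (r * cos (pi / J))\<^sup>2 / V)"
      using s V by (auto simp: s_def[symmetric] intro!: divide_left_mono)
    finally show "prob (E j) \<le> exp (- (r * cos (pi / J))\<^sup>2 / V)" .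
  qed
  finally show ?thesis unfolding Z_def by simp
qed

text \<open>Off this event the sum is at most \<open>A\<close> on the \<open>L \<times> L\<close> grid, and the bound \<open>B\<close> on its
  coefficients bounds its derivatives and hence its oscillation between grid points.\<close>

definition bad_event :: "int set \<Rightarrow> nat \<Rightarrow> real \<Rightarrow> real \<Rightarrow> 'w set" where
  "bad_event I L A B =
     (\<Union>(i, j)\<in>{..<L} \<times> {..<L}.
        {\<omega> \<in> space M. norm (wave_sum I (coeffs \<omega>) (2 * pi * real i / L) (2 * pi * real j / L)) > A}) \<union>
     (\<Union>n\<in>I. {\<omega> \<in> space M. norm (coeffs \<omega> n) > B})"

lemma wave_sum_measurable [measurable]: "(\<lambda>\<omega>. wave_sum I (coeffs \<omega>) t x) \<in> borel_measurable M"
  unfolding wave_sum_def by measurable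

lemma bad_event_events: "finite I \<Longrightarrow> bad_event I L A B \<in> events"
  unfolding bad_event_def by (intro sets.Un sets.finite_UN) auto

lemma not_bad_event:
  fixes L :: nat
  assumes "\<omega> \<in> space M" "\<omega> \<notin> bad_event I L A B" "L > 0" "\<And>n. n \<in> I \<Longrightarrow> \<bar>real_of_int n\<bar> \<le> N"
  shows "norm (wave_sum I (coeffs \<omega>) t x) \<le> A + card I * (B * ((N + N\<^sup>2) * (pi / L)))"
proof (rule wave_sum_grid[OF assms(3,4)])
  show "norm (coeffs \<omega> n) \<le> B" if "n \<in> I" for n
    using assms(1,2) that unfolding bad_event_def by force
  show "norm (wave_sum I (coeffs \<omega>) (2 * pi * real i / L) (2 * pi * real j / L)) \<le> A"
    if "i < L" "j < L" for i j
    using assms(1,2) that unfolding bad_event_def by force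
qed

lemma prob_bad_event_le:
  fixes J :: nat
  assumes I: "finite I" "I \<noteq> {}" and V: "(\<Sum>n\<in>I. (c n)\<^sup>2) \<le> V" and J: "J \<ge> 3" and A: "A \<ge> 0" and B: "B \<ge> 0"
  shows "prob (bad_event I L A B)
    \<le> (real L)\<^sup>2 * (J * exp (- (A * cos (pi / J))\<^sup>2 / V)) + card I * (4 * exp (- B\<^sup>2 / 2))"
proof -
  let ?G = "\<lambda>(i, j). {\<omega> \<in> space M. norm (wave_sum I (coeffs \<omega>) (2 * pi * real i / L) (2 * pi * real j / L)) > A}"
  let ?H = "\<lambda>n. {\<omega> \<in> space M. norm (coeffs \<omega> n) > B}"
  have "prob (bad_event I L A B) \<le> prob (\<Union>p\<in>{..<L}\<times>{..<L}. ?G p) + prob (\<Union>n\<in>I. ?H n)"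
    unfolding bad_event_def by (rule measure_Un_le) (use I in \<open>auto intro!: sets.finite_UN\<close>)
  also have "prob (\<Union>p\<in>{..<L}\<times>{..<L}. ?G p) \<le> (\<Sum>p\<in>{..<L}\<times>{..<L}. prob (?G p))"
    by (rule finite_measure_subadditive_finite) auto
  also have "\<dots> \<le> (\<Sum>p\<in>{..<L}\<times>{..<L}. J * exp (- (A * cos (pi / J))\<^sup>2 / V))"
  proof (rule sum_mono)
    fix p :: "nat \<times> nat"
    show "prob (?G p) \<le> J * exp (- (A * cos (pi / J))\<^sup>2 / V)"
      by (cases p) (simp only: prod.case wave_sum_def, rule prob_complex_sum_le[OF I V J A])
  qed
  also have "\<dots> = (real L)\<^sup>2 * (J * exp (- (A * cos (pi / J))\<^sup>2 / V))"
    by (simp add: power2_eq_square)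
  also have "prob (\<Union>n\<in>I. ?H n) \<le> (\<Sum>n\<in>I. prob (?H n))"
    by (rule finite_measure_subadditive_finite) (use I in auto)
  also have "\<dots> \<le> (\<Sum>n\<in>I. 4 * exp (- B\<^sup>2 / 2))"
  proof (rule sum_mono)
    fix n
    \<comment> \<open>A single coefficient is a one-frequency sum, taken with J = 4 and V = 1; cos
      (pi / 4)^2 = 1/2 gives the exponent B^2 / 2.\<close>
    have "prob {\<omega> \<in> space M. norm (\<Sum>n\<in>{n}. cis 0 * coeffs \<omega> n) > B}
        \<le> real 4 * exp (- (B * cos (pi / real 4))\<^sup>2 / 1)"
      by (rule prob_complex_sum_le[where I="{n}" and \<phi>="\<lambda>_. 0"]) (use c_sq_le_1 B in auto)
    then show "prob (?H n) \<le> 4 * exp (- B\<^sup>2 / 2)"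
      by (simp add: cos_45 power_mult_distrib power_divide)
  qed
  finally show ?thesis by simp
qed

section \<open>Uniform control of the tail\<close>

text \<open>Block k is allowed amplitude \<eta> (1 - q) q^k R, and these sum to \<eta> R. Its
  variance is O(q^(4 k)), so the Gaussian exponent grows at least like q^(- 2 k) and beats the grid
  size, which is only geometric in k. From \<open>K\<^sub>0\<close> on each block also yields the
  factor exp (- C R^2).\<close>

lemma tail_event:
  assumes eta: "\<eta> > 0" and C: "C > 0"
  obtains D K\<^sub>0 where "D > 0"
    "\<And>K R. K \<ge> K\<^sub>0 \<Longrightarrow> R \<ge> 1 \<Longrightarrow> \<exists>E\<in>events. prob E \<le> D * exp (- (C * R\<^sup>2)) \<and>
       (\<forall>\<omega>\<in>space M - E. \<forall>t x. norm (free_evolution (coeffs \<omega>) t x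
           - wave_sum {- int (2 ^ K - 1)..int (2 ^ K - 1)} (coeffs \<omega>) t x) \<le> \<eta> * R)"
proof -
  \<comment> \<open>q^4 = 2^(- 2 \<theta>) is the decay ratio of the block variances; the allowance
    q^k decays more slowly than the standard deviation scale q^(2 k).\<close>
  define q where "q = 2 powr (- \<theta> / 2)"
  have q0: "q > 0" unfolding q_def by simp
  have q1: "q < 1" unfolding q_def using theta_pos by (simp add: powr_less_one)
  have q4: "q ^ 4 = 2 powr (- (2 * \<theta>))" unfolding q_def by (simp add: powr_power)
  \<comment> \<open>Half of the allowance is for the values on the grid, half for the oscillation
    between grid points.\<close>
  define \<kappa> where "\<kappa> = \<eta> * (1 - q) / 2"
  have kappa: "\<kappa> > 0" unfolding \<kappa>_def using eta q1 by simp
  \<comment> \<open>The oscillation will be at most 256 * 16^k * R / L k; this mesh brings it below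
    \<kappa> q^k R.\<close>
  define L where "L k = nat \<lceil>256 / \<kappa> * (16 / q) ^ k\<rceil>" for k
  have L_pos: "L k > 0" for k unfolding L_def using kappa q0 by simp
  have L_ge: "256 / \<kappa> * (16 / q) ^ k \<le> L k" for k
    unfolding L_def by (rule real_nat_ceiling_ge)
  have L_le: "real (L k) \<le> (256 / \<kappa> + 1) * (16 / q) ^ k" for k
  proof -
    have "1 \<le> (16 / q) ^ k" using q0 q1 by (intro one_le_power) (simp add: le_divide_eq)
    moreover have "256 / \<kappa> * (16 / q) ^ k \<ge> 0" using kappa q0 by simp
    then have "real (L k) \<le> 256 / \<kappa> * (16 / q) ^ k + 1"
      unfolding L_def by (simp add: of_nat_nat)
    ultimately show ?thesis by (simp add: ring_distribs)
  qed
  \<comment> \<open>The part of block k up to frequency m: incomplete blocks are included because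
    the limit runs over all symmetric partial sums.\<close>
  define I where "I k m = {n::int. 2 ^ k \<le> \<bar>n\<bar> \<and> \<bar>n\<bar> \<le> int m}" for k m :: nat
  have I_sub: "I k m \<subseteq> {- (2 ^ (k + 1))..2 ^ (k + 1)}" if "m < 2 ^ (k + 1)" for k m
  proof -
    have "int m < 2 ^ (k + 1)" using that by (metis of_nat_less_iff of_nat_numeral of_nat_power)
    then show ?thesis unfolding I_def by auto
  qed
  have I_fin: "finite (I k m)" for k m
    by (rule finite_subset[of _ "{- int m..int m}"]) (auto simp: I_def)
  have I_card: "real (card (I k m)) \<le> 8 * 2 ^ k" if "m < 2 ^ (k + 1)" for k m
  proof -
    have "card (I k m) \<le> card {- (2 ^ (k + 1))..2 ^ (k + 1)::int}"
      by (rule card_mono[OF _ I_sub[OF that]]) simp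
    also have "\<dots> = nat (2 * 2 ^ (k + 1) + 1)" by simp
    also have "real \<dots> = 4 * 2 ^ k + 1" by (simp add: of_nat_nat)
    also have "\<dots> \<le> 8 * 2 ^ k" using one_le_power[of "2::real" k] by linarith
    finally show ?thesis by simp
  qed
  have I_ne: "I k m \<noteq> {}" if "2 ^ k \<le> m" for k m
  proof -
    have "(2::int) ^ k \<le> int m" using that by (metis of_nat_le_iff of_nat_numeral of_nat_power)
    then have "2 ^ k \<in> I k m" unfolding I_def by simp
    then show ?thesis by blast
  qed
  have I_abs: "\<bar>real_of_int n\<bar> \<le> 2 * 2 ^ k" if "n \<in> I k m" "m < 2 ^ (k + 1)" for n k m
  proof -
    have "n \<in> {- (2 ^ (k + 1))..2 ^ (k + 1)}" using I_sub[OF that(2)] that(1) by blast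
    then have "\<bar>n\<bar> \<le> 2 ^ (k + 1)" unfolding atLeastAtMost_iff by (intro abs_leI) linarith+
    then have "real_of_int \<bar>n\<bar> \<le> real_of_int (2 ^ (k + 1))" by (simp only: of_int_le_iff)
    then show ?thesis by simp
  qed
  have I_var: "(\<Sum>n\<in>I k m. (c n)\<^sup>2) \<le> 8 * (q ^ 4) ^ k" if "m < 2 ^ (k + 1)" for k m
  proof -
    have "(\<Sum>n\<in>I k m. (c n)\<^sup>2) \<le> (\<Sum>n\<in>I k m. (2 ^ k) powr (- (1 + 2 * \<theta>)))"
    proof (intro sum_mono c_sq_le)
      fix n assume "n \<in> I k m"
      then have "real_of_int (2 ^ k) \<le> real_of_int \<bar>n\<bar>" unfolding I_def by (simp only: of_int_le_iff mem_Collect_eq)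
      then show "2 ^ k \<le> \<bar>real_of_int n\<bar>" by simp
    qed simp
    also have "\<dots> = card (I k m) * (2 ^ k) powr (- (1 + 2 * \<theta>))" by simp
    also have "\<dots> \<le> 8 * 2 ^ k * (2 ^ k) powr (- (1 + 2 * \<theta>))"
      using I_card[OF that] by (intro mult_right_mono) auto
    also have "(2 ^ k) powr (- (1 + 2 * \<theta>)) = (2 powr (- 1) * 2 powr (- (2 * \<theta>))) ^ k"
      unfolding powr_add[symmetric] by (simp add: powr_realpow[symmetric] powr_powr powr_power mult.commute)
    also have "\<dots> = (q ^ 4) ^ k / 2 ^ k"
    proof -
      have "(2::real) powr (- 1) = 1 / 2" by (simp add: powr_minus)
      then show ?thesis unfolding q4 power_mult_distrib by (simp only: power_divide) simp
    qed
    finally show ?thesis by simp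
  qed
  \<comment> \<open>With J = 4 the exponent is (\<kappa> q^k R)^2 / 2 divided by the variance bound
    8 q^(4 k), that is, a Q^k R^2.\<close>
  define a where "a = \<kappa>\<^sup>2 / 16"
  define Q where "Q = 1 / q\<^sup>2"
  have a0: "a > 0" unfolding a_def using kappa by simp
  have Q1: "Q > 1" unfolding Q_def using q0 q1 by (simp add: less_divide_eq power_less_one_iff)
  define c\<^sub>1 where "c\<^sub>1 = 4 * (256 / \<kappa> + 1)\<^sup>2"
  have c1: "c\<^sub>1 \<ge> 0" unfolding c\<^sub>1_def by simp
  \<comment> \<open>A coefficient threshold growing with k makes the coefficient events summable
    over the blocks; the mesh L k absorbs the extra factor 2^k.\<close>
  define bad where "bad R k m = bad_event (I k m) (L k) (\<kappa> * q ^ k * R) (2 ^ k * R)" for R k m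
  have bad_prob: "prob (bad R k m) \<le> c\<^sub>1 * (256 / q\<^sup>2) ^ k * exp (- (a * Q ^ k * R\<^sup>2)) + 32 * 2 ^ k * exp (- (4 ^ k / 2 * R\<^sup>2))"
    if m: "2 ^ k \<le> m" "m < 2 ^ (k + 1)" and R: "R \<ge> 1" for R k m
  proof -
    have "prob (bad R k m) \<le> (real (L k))\<^sup>2 * (real 4 * exp (- (\<kappa> * q ^ k * R * cos (pi / real 4))\<^sup>2 / (8 * (q ^ 4) ^ k)))
        + card (I k m) * (4 * exp (- (2 ^ k * R)\<^sup>2 / 2))"
      unfolding bad_def
      by (rule prob_bad_event_le[OF I_fin I_ne[OF m(1)] I_var[OF m(2)]]) (use R kappa q0 in auto)
    also have "- (\<kappa> * q ^ k * R * cos (pi / real 4))\<^sup>2 / (8 * (q ^ 4) ^ k) = - (a * Q ^ k * R\<^sup>2)"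
    proof -
      define p where "p = (q ^ k)\<^sup>2"
      have p0: "p > 0" unfolding p_def using q0 by simp
      have e1: "(q ^ 4) ^ k = p * p"
        unfolding p_def by (simp add: power_mult[symmetric] power_add[symmetric] mult.commute)
      have e2: "Q ^ k = 1 / p"
        unfolding Q_def p_def by (simp add: power_divide power_mult[symmetric] mult.commute)
      have e3: "(\<kappa> * q ^ k * R * cos (pi / real 4))\<^sup>2 = \<kappa>\<^sup>2 * p * R\<^sup>2 / 2"
        unfolding p_def by (simp add: cos_45 power_mult_distrib power_divide)
      show ?thesis unfolding e1 e2 e3 a_def using p0 by (simp add: field_simps)
    qed
    also have "- (2 ^ k * R)\<^sup>2 / 2 = - (4 ^ k / 2 * R\<^sup>2)"
      by (simp add: power_mult_distrib power2_eq_square flip: power_mult_distrib)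
    also have "(real (L k))\<^sup>2 * (real 4 * exp (- (a * Q ^ k * R\<^sup>2)))
        \<le> ((256 / \<kappa> + 1) * (16 / q) ^ k)\<^sup>2 * (real 4 * exp (- (a * Q ^ k * R\<^sup>2)))"
      using L_le by (intro mult_right_mono power_mono) auto
    also have "\<dots> = c\<^sub>1 * (256 / q\<^sup>2) ^ k * exp (- (a * Q ^ k * R\<^sup>2))"
    proof -
      have "((16 / q) ^ k)\<^sup>2 = ((16 / q)\<^sup>2) ^ k" by (simp only: power_mult[symmetric] mult.commute)
      also have "(16 / q)\<^sup>2 = 256 / q\<^sup>2" by (simp add: power_divide)
      finally show ?thesis by (simp add: c\<^sub>1_def power_mult_distrib)
    qed
    also have "real (card (I k m)) * (4 * exp (- (4 ^ k / 2 * R\<^sup>2))) \<le> 8 * 2 ^ k * (4 * exp (- (4 ^ k / 2 * R\<^sup>2)))"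
      using I_card[OF m(2)] by (intro mult_right_mono) auto
    finally show ?thesis by simp
  qed
  have bad_small: "norm (wave_sum (I k m) (coeffs \<omega>) t x) \<le> \<eta> * (1 - q) * q ^ k * R"
    if w: "\<omega> \<in> space M" "\<omega> \<notin> bad R k m" and m: "2 ^ k \<le> m" "m < 2 ^ (k + 1)" and R: "R \<ge> 1" for \<omega> R k m t x
  proof -
    have "norm (wave_sum (I k m) (coeffs \<omega>) t x)
        \<le> \<kappa> * q ^ k * R + card (I k m) * (2 ^ k * R * ((2 * 2 ^ k + (2 * 2 ^ k)\<^sup>2) * (pi / L k)))"
      by (rule not_bad_event[OF w(1) w(2)[unfolded bad_def] L_pos]) (use I_abs m in auto)
    also have "card (I k m) * (2 ^ k * R * ((2 * 2 ^ k + (2 * 2 ^ k)\<^sup>2) * (pi / L k)))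
        \<le> 8 * 2 ^ k * (2 ^ k * R * (8 * (2 ^ k)\<^sup>2 * (4 / L k)))"
    proof (intro mult_mono divide_right_mono)
      show "real (card (I k m)) \<le> 8 * 2 ^ k" by (rule I_card[OF m(2)])
      have "(2::real) ^ k \<le> (2 ^ k)\<^sup>2" by (simp add: power2_eq_square)
      then show "2 * 2 ^ k + (2 * 2 ^ k)\<^sup>2 \<le> 8 * (2 ^ k :: real)\<^sup>2"
        using four_x_squared[of "2 ^ k"] zero_le_power2[of "2 ^ k :: real"] by linarith
      show "pi \<le> 4" using pi_less_4 by simp
    qed (use R in auto)
    also have "\<dots> = 256 * 16 ^ k * R / L k"
    proof -
      have "(16::real) ^ k = 2 ^ k * 2 ^ k * (2 ^ k)\<^sup>2"
        by (simp add: power2_eq_square flip: power_mult_distrib)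
      then show ?thesis by simp
    qed
    also have "\<dots> \<le> \<kappa> * q ^ k * R"
    proof -
      have "256 * 16 ^ k \<le> \<kappa> * q ^ k * L k"
        using mult_left_mono[OF L_ge[of k], of "\<kappa> * q ^ k"] kappa q0
        by (simp add: power_divide mult.assoc)
      then have "256 * 16 ^ k * R \<le> \<kappa> * q ^ k * L k * R" using R by (intro mult_right_mono) auto
      then show ?thesis using L_pos[of k] by (simp add: divide_le_eq mult_ac)
    qed
    finally show ?thesis unfolding \<kappa>_def by (simp add: field_simps)
  qed
  \<comment> \<open>Majorant left after exp (- C R^2) is taken out. Compared with
    \<open>bad_prob\<close> both bases are doubled, 512 for 256 and 4 for 2, to pay for the 2^k
    values of m in a block.\<close>
  define Y where "Y k = c\<^sub>1 * ((512 / q\<^sup>2) ^ k * exp (- (a / 2 * Q ^ k))) + 32 * (4 ^ k * exp (- (1 / 4 * 4 ^ k)))" for k :: nat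
  have Ysum: "summable Y" unfolding Y_def
    by (intro summable_add summable_mult summable_power_exp) (use a0 Q1 q0 in auto)
  have Y0: "Y k \<ge> 0" for k unfolding Y_def using c1 q0 by simp
  define blk where "blk R k = (\<Union>m\<in>{2 ^ k..<2 ^ (k + 1)}. bad R k m)" for R k
  have bad_ev [measurable]: "bad R k m \<in> events" for R k m
    unfolding bad_def by (rule bad_event_events[OF I_fin])
  have blk_ev [measurable]: "blk R k \<in> events" for R k unfolding blk_def by measurable
  \<comment> \<open>Half of the exponent pays for \<open>exp (- C * R\<^sup>2)\<close>, the other half makes the sum over \<open>k\<close> converge.\<close>
  have exp_split: "exp (- (y * R\<^sup>2)) \<le> exp (- (C * R\<^sup>2)) * exp (- (y / 2))" if "y \<ge> 2 * C" "R \<ge> 1" for y R :: real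
  proof -
    have "y / 2 * 1 \<le> y / 2 * R\<^sup>2" using that C by (intro mult_left_mono one_le_power) auto
    moreover have "C * R\<^sup>2 \<le> y / 2 * R\<^sup>2" using that by (intro mult_right_mono) auto
    ultimately show ?thesis unfolding exp_add[symmetric] by simp
  qed
  have blk_prob: "prob (blk R k) \<le> exp (- (C * R\<^sup>2)) * Y k"
    if k: "a * Q ^ k \<ge> 2 * C" "4 ^ k / 2 \<ge> 2 * C" and R: "R \<ge> 1" for R k
  proof -
    have "prob (blk R k) \<le> (\<Sum>m\<in>{2 ^ k..<2 ^ (k + 1)}. prob (bad R k m))"
      unfolding blk_def by (rule finite_measure_subadditive_finite) auto
    also have "\<dots> \<le> (\<Sum>m\<in>{2 ^ k..<2 ^ (k + 1)::nat}. exp (- (C * R\<^sup>2)) * (Y k / 2 ^ k))"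
    proof (rule sum_mono)
      fix m :: nat assume m: "m \<in> {2 ^ k..<2 ^ (k + 1)}"
      have "prob (bad R k m) \<le> c\<^sub>1 * (256 / q\<^sup>2) ^ k * exp (- (a * Q ^ k * R\<^sup>2)) + 32 * 2 ^ k * exp (- (4 ^ k / 2 * R\<^sup>2))"
        using m R by (intro bad_prob) auto
      also have "\<dots> \<le> c\<^sub>1 * (256 / q\<^sup>2) ^ k * (exp (- (C * R\<^sup>2)) * exp (- (a * Q ^ k / 2)))
          + 32 * 2 ^ k * (exp (- (C * R\<^sup>2)) * exp (- (4 ^ k / 2 / 2)))"
        using exp_split[OF k(1) R] exp_split[OF k(2) R] c1 q0
        by (intro add_mono mult_left_mono) auto
      also have "\<dots> = exp (- (C * R\<^sup>2)) * (Y k / 2 ^ k)"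
      proof -
        have e1: "(512 / q\<^sup>2) ^ k = 2 ^ k * (256 / q\<^sup>2) ^ k" by (simp flip: power_mult_distrib)
        have e2: "(4::real) ^ k = 2 ^ k * 2 ^ k" by (simp flip: power_mult_distrib)
        show ?thesis unfolding Y_def e1 e2 by (simp add: add_divide_distrib algebra_simps)
      qed
      finally show "prob (bad R k m) \<le> exp (- (C * R\<^sup>2)) * (Y k / 2 ^ k)" .
    qed
    also have "\<dots> = exp (- (C * R\<^sup>2)) * Y k" by simp
    finally show ?thesis .
  qed
  obtain K\<^sub>0 where K0: "\<And>k. k \<ge> K\<^sub>0 \<Longrightarrow> a * Q ^ k \<ge> 2 * C \<and> 4 ^ k / 2 \<ge> 2 * C"
  proof -
    obtain k\<^sub>1 where k1: "2 * C / a < Q ^ k\<^sub>1" using real_arch_pow[OF Q1] by blast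
    obtain k\<^sub>2 where k2: "4 * C < (4::real) ^ k\<^sub>2" using real_arch_pow[of 4] by auto
    show ?thesis
    proof (rule that[of "max k\<^sub>1 k\<^sub>2"])
      fix k assume k: "k \<ge> max k\<^sub>1 k\<^sub>2"
      have "Q ^ k\<^sub>1 \<le> Q ^ k" using k Q1 by (intro power_increasing) auto
      then have "2 * C / a \<le> Q ^ k" using k1 by linarith
      moreover have "(4::real) ^ k\<^sub>2 \<le> 4 ^ k" using k by (intro power_increasing) auto
      then have "4 ^ k / 2 \<ge> 2 * C" using k2 by linarith
      ultimately show "a * Q ^ k \<ge> 2 * C \<and> 4 ^ k / 2 \<ge> 2 * C"
        using a0 by (simp add: divide_le_eq mult.commute)
    qed
  qed
  show ?thesis
  proof (rule that[of "suminf Y + 1" K\<^sub>0])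
    show "suminf Y + 1 > 0" using suminf_nonneg[OF Ysum Y0] by simp
    fix K and R :: real assume K: "K \<ge> K\<^sub>0" and R: "R \<ge> 1"
    \<comment> \<open>Off this event every block from K on is good, for each m in it.\<close>
    define E where "E = (\<Union>k. blk R (k + K))"
    have Ev: "E \<in> events" unfolding E_def by measurable
    have YK: "summable (\<lambda>k. exp (- (C * R\<^sup>2)) * Y (k + K))"
      using Ysum by (intro summable_mult) (simp add: summable_iff_shift)
    have le: "prob (blk R (k + K)) \<le> exp (- (C * R\<^sup>2)) * Y (k + K)" for k
      by (rule blk_prob) (use K0[of "k + K"] K R in auto)
    have sm: "summable (\<lambda>k. prob (blk R (k + K)))"
      by (rule summable_comparison_test'[OF YK, of 0]) (use le in simp)
    have "prob E \<le> (\<Sum>k. prob (blk R (k + K)))"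
      unfolding E_def by (rule finite_measure_subadditive_countably[OF _ sm]) auto
    also have "\<dots> \<le> (\<Sum>k. exp (- (C * R\<^sup>2)) * Y (k + K))"
      by (rule suminf_le[OF le sm YK])
    also have "\<dots> = exp (- (C * R\<^sup>2)) * (\<Sum>k. Y (k + K))"
      by (rule suminf_mult) (use Ysum in \<open>simp add: summable_iff_shift\<close>)
    also have "\<dots> \<le> exp (- (C * R\<^sup>2)) * (suminf Y + 1)"
      using suminf_split_initial_segment[OF Ysum, of K] sum_nonneg[of "{..<K}" Y] Y0
      by (intro mult_left_mono) auto
    finally have "prob E \<le> (suminf Y + 1) * exp (- (C * R\<^sup>2))" by (simp add: mult.commute)
    moreover have "norm (free_evolution (coeffs \<omega>) t x
           - wave_sum {- int (2 ^ K - 1)..int (2 ^ K - 1)} (coeffs \<omega>) t x) \<le> \<eta> * R"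
      if w: "\<omega> \<in> space M - E" for \<omega> t x
    proof -
      have geo: "summable (\<lambda>k. \<eta> * (1 - q) * q ^ k * R)" "(\<Sum>k. \<eta> * (1 - q) * q ^ k * R) = \<eta> * R"
        using sums_mult2[OF sums_mult[OF geometric_sums[of q], of "\<eta> * (1 - q)"], of R] q0 q1
        by (auto simp: sums_iff)
      have "norm (free_evolution (coeffs \<omega>) t x
           - wave_sum {- int (2 ^ K - 1)..int (2 ^ K - 1)} (coeffs \<omega>) t x)
        \<le> (\<Sum>k. \<eta> * (1 - q) * q ^ k * R)"
        unfolding free_evolution_eq_lim
      proof (rule dyadic_limit_bound[OF geo(1)])
        show "0 \<le> \<eta> * (1 - q) * q ^ k * R" for k using eta q0 q1 R by simp
        fix k m :: nat assume k: "k \<ge> K" and m: "2 ^ k \<le> m" "m < 2 ^ (k + 1)"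
        have "\<omega> \<notin> blk R ((k - K) + K)" using w unfolding E_def by blast
        then have nb: "\<omega> \<notin> bad R k m" using k m unfolding blk_def by auto
        define p where "p = (2::int) ^ k"
        have p: "p \<le> int m" unfolding p_def using m(1) by (metis of_nat_le_iff of_nat_numeral of_nat_power)
        have pe: "int (2 ^ k - 1) = p - 1" unfolding p_def by (simp add: of_nat_diff)
        have split: "{- int m..int m} = {- int (2 ^ k - 1)..int (2 ^ k - 1)} \<union> I k m"
          using p unfolding I_def pe p_def[symmetric] by auto
        have "{- int (2 ^ k - 1)..int (2 ^ k - 1)} \<inter> I k m = {}"
          unfolding I_def pe p_def[symmetric] by auto
        then have "wave_sum {- int m..int m} (coeffs \<omega>) t x
            = wave_sum {- int (2 ^ k - 1)..int (2 ^ k - 1)} (coeffs \<omega>) t x + wave_sum (I k m) (coeffs \<omega>) t x"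
          unfolding split wave_sum_def by (intro sum.union_disjoint I_fin) auto
        then show "norm (wave_sum {- int m..int m} (coeffs \<omega>) t x
            - wave_sum {- int (2 ^ k - 1)..int (2 ^ k - 1)} (coeffs \<omega>) t x) \<le> \<eta> * (1 - q) * q ^ k * R"
          using bad_small[OF _ nb m R] w by simp
      qed
      then show ?thesis unfolding geo(2) .
    qed
    ultimately show "\<exists>E\<in>events. prob E \<le> (suminf Y + 1) * exp (- (C * R\<^sup>2)) \<and>
       (\<forall>\<omega>\<in>space M - E. \<forall>t x. norm (free_evolution (coeffs \<omega>) t x
           - wave_sum {- int (2 ^ K - 1)..int (2 ^ K - 1)} (coeffs \<omega>) t x) \<le> \<eta> * R)"
      using Ev by blast
  qed
qed

section \<open>The total variance\<close>

lemma summable_c_sq: "(\<lambda>n. (c n)\<^sup>2) summable_on UNIV"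
proof -
  have nat: "(\<lambda>n::nat. (c (s * int n))\<^sup>2) summable_on UNIV" if s: "\<bar>s\<bar> = 1" for s
  proof (rule norm_summable_imp_summable_on)
    have "summable (\<lambda>n. real n powr (- (1 + 2 * \<theta>)))"
      using theta_pos by (simp add: summable_real_powr_iff)
    then show "summable (\<lambda>n. norm ((c (s * int n))\<^sup>2))"
    proof (rule summable_comparison_test'[of _ 1])
      fix n :: nat assume "n \<ge> 1"
      then show "norm (norm ((c (s * int n))\<^sup>2)) \<le> real n powr (- (1 + 2 * \<theta>))"
        using c_sq_le[of "real n" "s * int n"] s by (simp add: abs_mult flip: of_int_abs)
    qed
  qed
  have "(\<lambda>n. (c n)\<^sup>2) summable_on range (\<lambda>n. s * int n)" if "\<bar>s\<bar> = 1" for s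
    using nat[OF that] that by (subst summable_on_reindex) (auto simp: inj_on_def comp_def)
  from this[of 1] this[of "- 1"]
  have "(\<lambda>n. (c n)\<^sup>2) summable_on (range (\<lambda>n. 1 * int n) \<union> range (\<lambda>n. - 1 * int n))"
    by (intro summable_on_union) auto
  moreover have "(UNIV::int set) = range (\<lambda>n. 1 * int n) \<union> range (\<lambda>n. - 1 * int n)"
    by (auto simp: image_iff) (metis int_cases2)
  ultimately show ?thesis by simp
qed

text \<open>The variance of the random field at any fixed (t, x); it does not depend on the point
  since all phases have modulus 1.\<close>

definition total_var :: real where "total_var = (\<Sum>\<^sub>\<infinity>n\<in>UNIV. (c n)\<^sup>2)"

lemma sum_c_sq_le_total_var: "finite I \<Longrightarrow> (\<Sum>n\<in>I. (c n)\<^sup>2) \<le> total_var"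
  unfolding total_var_def by (rule finite_sum_le_infsum[OF summable_c_sq]) auto

lemma total_var_pos: "total_var > 0"
  using sum_c_sq_le_total_var[of "{0}"] c_pos[of 0] by (simp add: less_le_trans[OF zero_less_power])

text \<open>Finite sets approximate the infinite sum and each lies in a symmetric interval. The
  lower bound can thus use a partial sum carrying almost all the variance.\<close>

lemma symmetric_partial_var:
  assumes "s < total_var"
  obtains K\<^sub>1 where "\<And>K. K \<ge> K\<^sub>1 \<Longrightarrow> s < (\<Sum>n\<in>{- int (2 ^ K - 1)..int (2 ^ K - 1)}. (c n)\<^sup>2)"
proof -
  have "((\<lambda>n. (c n)\<^sup>2) has_sum total_var) UNIV"
    unfolding total_var_def using summable_c_sq by (rule has_sum_infsum)
  then have "\<forall>\<^sub>F F in finite_subsets_at_top UNIV. s < (\<Sum>n\<in>F. (c n)\<^sup>2)"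
    unfolding has_sum_def using assms by (rule order_tendstoD(1))
  then obtain F where F: "finite F" "s < (\<Sum>n\<in>F. (c n)\<^sup>2)"
    unfolding eventually_finite_subsets_at_top by blast
  obtain N where N: "\<And>n. n \<in> F \<Longrightarrow> \<bar>n\<bar> \<le> int N"
  proof
    fix n assume "n \<in> F"
    then have "nat \<bar>n\<bar> \<le> Max ((\<lambda>n. nat \<bar>n\<bar>) ` F)" using F(1) by (intro Max_ge) auto
    then show "\<bar>n\<bar> \<le> int (Max ((\<lambda>n. nat \<bar>n\<bar>) ` F))" by linarith
  qed
  show ?thesis
  proof (rule that[of N])
    fix K assume "K \<ge> N"
    moreover have "K < 2 ^ K" by (rule less_exp)
    ultimately have "N \<le> 2 ^ K - 1" by linarith
    then have "\<bar>n\<bar> \<le> int (2 ^ K - 1)" if "n \<in> F" for n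
      using N[OF that] by (meson of_nat_le_iff order_trans)
    then have "F \<subseteq> {- int (2 ^ K - 1)..int (2 ^ K - 1)}" by (force simp: abs_le_iff)
    then have "(\<Sum>n\<in>F. (c n)\<^sup>2) \<le> (\<Sum>n\<in>{- int (2 ^ K - 1)..int (2 ^ K - 1)}. (c n)\<^sup>2)"
      by (intro sum_mono2) auto
    then show "s < (\<Sum>n\<in>{- int (2 ^ K - 1)..int (2 ^ K - 1)}. (c n)\<^sup>2)" using F(2) by linarith
  qed
qed

section \<open>Measurability of the deviation event\<close>

text \<open>Joint measurability is needed because the deviation event is read off from the measures
  of the sections of one set in the product space.\<close>

lemma free_evolution_measurable_pair:
  "(\<lambda>y. free_evolution (coeffs (fst y)) (fst (snd y)) (snd (snd y))) \<in> borel_measurable (M \<Otimes>\<^sub>M (borel :: (real \<times> real) measure))"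
proof -
  have [measurable]: "(\<lambda>y. fst (snd y)) \<in> borel_measurable (M \<Otimes>\<^sub>M (borel :: (real \<times> real) measure))"
    "(\<lambda>y. snd (snd y)) \<in> borel_measurable (M \<Otimes>\<^sub>M (borel :: (real \<times> real) measure))"
    unfolding borel_prod[symmetric] by measurable
  have [measurable]: "cis \<in> borel_measurable borel"
    by (intro borel_measurable_continuous_onI continuous_on_cis continuous_on_id)
  have [measurable]: "(\<lambda>y. g n (fst y)) \<in> borel_measurable (M \<Otimes>\<^sub>M (borel :: (real \<times> real) measure))" for n
    by (rule measurable_compose[OF measurable_fst g_measurable])
  show ?thesis unfolding free_evolution_eq_lim wave_sum_def by measurable
qed

lemma free_evolution_measurable:
  assumes "\<omega> \<in> space M"
  shows "(\<lambda>p. free_evolution (coeffs \<omega>) (fst p) (snd p)) \<in> borel_measurable borel"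
  using measurable_Pair2[OF free_evolution_measurable_pair assms] by simp

definition deviation :: "real \<Rightarrow> real \<Rightarrow> 'w set" where
  "deviation T z = {\<omega> \<in> space M. Linfty_norm_tx T (free_evolution (coeffs \<omega>)) > ereal z}"

text \<open>Not a formality: \<open>measure\<close> is \<open>0\<close> on non-measurable sets, which would falsify the lower bound.\<close>

lemma deviation_events: "deviation T z \<in> events"
proof -
  let ?N = "M \<Otimes>\<^sub>M (lborel :: (real \<times> real) measure)"
  let ?X = "{0..T} \<times> {0..2 * pi}"
  define Q where "Q = {y \<in> space ?N. snd y \<in> ?X \<and> norm (free_evolution (coeffs (fst y)) (fst (snd y)) (snd (snd y))) > z}"
  have X [measurable]: "?X \<in> sets borel" by (intro borel_closed closed_Times closed_atLeastAtMost)
  have sets_eq: "sets ?N = sets (M \<Otimes>\<^sub>M (borel :: (real \<times> real) measure))"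
    by (rule sets_pair_measure_cong) auto
  have [measurable]: "(\<lambda>y. free_evolution (coeffs (fst y)) (fst (snd y)) (snd (snd y))) \<in> borel_measurable ?N"
    using free_evolution_measurable_pair by (simp only: measurable_cong_sets[OF sets_eq refl])
  have Q: "Q \<in> sets ?N" unfolding Q_def by measurable
  have [measurable]: "(\<lambda>\<omega>. emeasure lborel (Pair \<omega> -` Q)) \<in> borel_measurable M"
    by (rule lborel.measurable_emeasure_Pair[OF Q])
  have "deviation T z = {\<omega> \<in> space M. emeasure lborel (Pair \<omega> -` Q) > 0}"
    unfolding deviation_def
  proof (intro Collect_cong conj_cong refl)
    fix \<omega> assume w: "\<omega> \<in> space M"
    then have "Pair \<omega> -` Q = {p. p \<in> ?X \<and> norm (free_evolution (coeffs \<omega>) (fst p) (snd p)) > z}"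
      unfolding Q_def by (auto simp: space_pair_measure)
    then show "Linfty_norm_tx T (free_evolution (coeffs \<omega>)) > ereal z \<longleftrightarrow> emeasure lborel (Pair \<omega> -` Q) > 0"
      using Linfty_norm_tx_gt_iff[OF free_evolution_measurable[OF w]] by simp
  qed
  then show ?thesis by simp
qed

section \<open>Upper bound for the deviation probability\<close>

text \<open>A deviation forces a large tail or a large partial sum. The exceptional events for these
  control all t and x at once, so D depends on neither T nor R.\<close>

lemma prob_deviation_le:
  assumes z0: "z0 > 0" and w: "w < z0\<^sup>2 / total_var"
  obtains D where "D > 0" "\<And>R T. R \<ge> 1 \<Longrightarrow> prob (deviation T (z0 * R)) \<le> D * exp (- (w * R\<^sup>2))"
proof -
  let ?W = "z0\<^sup>2 / total_var"
  have W: "?W > 0" using z0 total_var_pos by simp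
  \<comment> \<open>w' leaves room between w and the true rate, and z1 below is the level whose rate
    is w'.\<close>
  then obtain w' where w': "max w 0 < w'" "w' < ?W" using dense[of "max w 0" ?W] w by auto
  define z1 where "z1 = sqrt (w' * total_var)"
  have z1: "z1 > 0" "z1\<^sup>2 = w' * total_var" unfolding z1_def using w' total_var_pos by auto
  have "z1\<^sup>2 < z0\<^sup>2" using w'(2) total_var_pos z1(2) by (simp add: less_divide_eq)
  then have z10: "z1 < z0" by (rule power2_less_imp_less) (use z0 in simp)
  \<comment> \<open>Enough directions make the loss cos (pi / J)^2 so mild that the rate stays above
    w.\<close>
  have "(\<lambda>J::nat. w' * (cos (pi / J))\<^sup>2) \<longlonglongrightarrow> w' * (cos 0)\<^sup>2"
    by (intro tendsto_intros tendsto_divide_0[OF tendsto_const] filterlim_at_top_imp_at_infinity filterlim_real_sequentially)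
  then have "\<forall>\<^sub>F J in sequentially. w < w' * (cos (pi / real J))\<^sup>2"
    by (rule order_tendstoD(1)) (use w' in auto)
  then have "\<forall>\<^sub>F J in sequentially. w < w' * (cos (pi / real J))\<^sup>2 \<and> J \<ge> 3"
    using eventually_ge_at_top by (rule eventually_conj)
  then obtain J :: nat where J: "w < w' * (cos (pi / J))\<^sup>2" "J \<ge> 3"
    unfolding eventually_sequentially by blast
  \<comment> \<open>The gap z0 - z1 is shared equally by the tail and the oscillation of the partial
    sum off the grid.\<close>
  define \<eta> where "\<eta> = (z0 - z1) / 2"
  have eta: "\<eta> > 0" unfolding \<eta>_def using z10 by simp
  obtain D\<^sub>1 K where D1: "D\<^sub>1 > 0"
    "\<And>K' R. K' \<ge> K \<Longrightarrow> R \<ge> 1 \<Longrightarrow> \<exists>E\<in>events. prob E \<le> D\<^sub>1 * exp (- (?W * R\<^sup>2)) \<and>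
       (\<forall>\<omega>\<in>space M - E. \<forall>t x. norm (free_evolution (coeffs \<omega>) t x
           - wave_sum {- int (2 ^ K' - 1)..int (2 ^ K' - 1)} (coeffs \<omega>) t x) \<le> \<eta> * R)"
    by (rule tail_event[OF eta W], rule that)
  define I where "I = {- int (2 ^ K - 1)..int (2 ^ K - 1)}"
  have "finite I" "0 \<in> I" unfolding I_def atLeastAtMost_iff by (rule finite_atLeastAtMost_int, linarith)
  then have I: "finite I" "I \<noteq> {}" by auto
  define N where "N = real_of_int (int (2 ^ K - 1))"
  have N: "\<bar>real_of_int n\<bar> \<le> N" if "n \<in> I" for n
  proof -
    have "\<bar>n\<bar> \<le> int (2 ^ K - 1)" using that unfolding I_def by auto
    then show ?thesis unfolding N_def by (simp only: of_int_abs[symmetric] of_int_le_iff)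
  qed
  \<comment> \<open>Chosen so that exp (- (b R)^2 / 2) = exp (- z0^2 R^2 / total_var).\<close>
  define b where "b = sqrt (2 * ?W)"
  have b: "b \<ge> 0" "b\<^sup>2 = 2 * ?W" unfolding b_def using W by auto
  \<comment> \<open>The coefficient bound b R and the allowance \<eta> R scale alike, so one grid
    serves all R.\<close>
  define L where "L = nat \<lceil>card I * (b * ((N + N\<^sup>2) * pi)) / \<eta>\<rceil> + 1"
  have L_pos: "L > 0" unfolding L_def by simp
  have "card I * (b * ((N + N\<^sup>2) * pi)) / \<eta> \<le> L" unfolding L_def by linarith
  then have L: "card I * (b * ((N + N\<^sup>2) * (pi / L))) \<le> \<eta>"
    using eta L_pos by (simp add: field_simps)
  define D where "D = D\<^sub>1 + (real L)\<^sup>2 * J + card I * 4"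
  show ?thesis
  proof (rule that[of D])
    show "D > 0" unfolding D_def using D1(1) by (intro add_pos_nonneg) auto
    fix R T :: real assume R: "R \<ge> 1"
    obtain E where E: "E \<in> events" "prob E \<le> D\<^sub>1 * exp (- (?W * R\<^sup>2))"
      "\<And>\<omega> t x. \<omega> \<in> space M - E \<Longrightarrow> norm (free_evolution (coeffs \<omega>) t x - wave_sum I (coeffs \<omega>) t x) \<le> \<eta> * R"
      using D1(2)[OF order_refl R] unfolding I_def by blast
    define B where "B = bad_event I L (z1 * R) (b * R)"
    have B: "B \<in> events" unfolding B_def by (rule bad_event_events[OF I(1)])
    have exp_le: "exp (- (?W * R\<^sup>2)) \<le> exp (- (w * R\<^sup>2))"
      using mult_right_mono[of w ?W "R\<^sup>2"] w by simp
    have sub: "deviation T (z0 * R) \<subseteq> E \<union> B"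
    proof
      fix \<omega> assume "\<omega> \<in> deviation T (z0 * R)"
      then have w: "\<omega> \<in> space M" and gt: "Linfty_norm_tx T (free_evolution (coeffs \<omega>)) > ereal (z0 * R)"
        unfolding deviation_def by auto
      have "{p. p \<in> {0..T} \<times> {0..2 * pi} \<and> norm (free_evolution (coeffs \<omega>) (fst p) (snd p)) > z0 * R} \<noteq> {}"
        using gt unfolding Linfty_norm_tx_gt_iff[OF free_evolution_measurable[OF w]] by (metis emeasure_empty less_irrefl)
      then obtain t x where tx: "norm (free_evolution (coeffs \<omega>) t x) > z0 * R" by auto
      show "\<omega> \<in> E \<union> B"
      proof (rule ccontr)
        assume n: "\<omega> \<notin> E \<union> B"
        have "norm (wave_sum I (coeffs \<omega>) t x) \<le> z1 * R + card I * (b * R * ((N + N\<^sup>2) * (pi / L)))"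
          by (rule not_bad_event[OF w _ L_pos N]) (use n in \<open>auto simp: B_def\<close>)
        also have "card I * (b * R * ((N + N\<^sup>2) * (pi / L))) = card I * (b * ((N + N\<^sup>2) * (pi / L))) * R"
          by (simp only: mult_ac)
        also have "\<dots> \<le> \<eta> * R" using L R by (intro mult_right_mono) auto
        finally have "norm (wave_sum I (coeffs \<omega>) t x) \<le> z1 * R + \<eta> * R" by simp
        moreover have "norm (free_evolution (coeffs \<omega>) t x - wave_sum I (coeffs \<omega>) t x) \<le> \<eta> * R"
          using E(3) n w by blast
        ultimately have "norm (free_evolution (coeffs \<omega>) t x) \<le> z1 * R + \<eta> * R + \<eta> * R"
          using norm_triangle_sub[of "free_evolution (coeffs \<omega>) t x" "wave_sum I (coeffs \<omega>) t x"] by linarith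
        also have "\<dots> = z0 * R" unfolding \<eta>_def by (simp add: field_simps)
        finally show False using tx by simp
      qed
    qed
    have "prob (deviation T (z0 * R)) \<le> prob (E \<union> B)"
      by (rule finite_measure_mono[OF sub]) (use E B in auto)
    also have "\<dots> \<le> prob E + prob B" by (rule measure_Un_le) (use E B in auto)
    also have "prob E \<le> D\<^sub>1 * exp (- (w * R\<^sup>2))"
      using E(2) mult_left_mono[OF exp_le, of D\<^sub>1] D1(1) by linarith
    also have "prob B \<le> (real L)\<^sup>2 * (J * exp (- (z1 * R * cos (pi / J))\<^sup>2 / total_var)) + card I * (4 * exp (- (b * R)\<^sup>2 / 2))"
      unfolding B_def
      by (rule prob_bad_event_le[OF I sum_c_sq_le_total_var[OF I(1)] J(2)]) (use z1 R b in auto)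
    also have "- (b * R)\<^sup>2 / 2 = - (?W * R\<^sup>2)" using b(2) by (simp add: power_mult_distrib)
    also have "- (z1 * R * cos (pi / J))\<^sup>2 / total_var = - (w' * (cos (pi / J))\<^sup>2 * R\<^sup>2)"
      using z1(2) total_var_pos by (simp add: power_mult_distrib)
    also have "(real L)\<^sup>2 * (J * exp (- (w' * (cos (pi / J))\<^sup>2 * R\<^sup>2))) + card I * (4 * exp (- (?W * R\<^sup>2)))
        \<le> (real L)\<^sup>2 * (J * exp (- (w * R\<^sup>2))) + card I * (4 * exp (- (w * R\<^sup>2)))"
    proof (intro add_mono mult_left_mono exp_le)
      show "exp (- (w' * (cos (pi / J))\<^sup>2 * R\<^sup>2)) \<le> exp (- (w * R\<^sup>2))"
        using mult_right_mono[OF less_imp_le[OF J(1)], of "R\<^sup>2"] by simp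
    qed auto
    finally show "prob (deviation T (z0 * R)) \<le> D * exp (- (w * R\<^sup>2))"
      unfolding D_def by (simp add: ring_distribs mult.assoc)
  qed
qed

section \<open>Lower bound for the deviation probability\<close>

text \<open>The partial sum is continuous, hence stays above z + e on a small box at the corner (0,
  0). Uniform closeness carries the level z over to the evolution without any continuity of the
  latter, and the box has positive measure however small T is.\<close>

lemma Linfty_norm_tx_gt_of_wave_sum:
  assumes w: "\<omega> \<in> space M" and T: "T > 0" and z: "norm (wave_sum I (coeffs \<omega>) 0 0) > z + e"
    and e: "\<And>t x. norm (free_evolution (coeffs \<omega>) t x - wave_sum I (coeffs \<omega>) t x) \<le> e"
  shows "\<omega> \<in> deviation T z"
proof -
  let ?A = "{p. p \<in> {0..T} \<times> {0..2 * pi} \<and> norm (free_evolution (coeffs \<omega>) (fst p) (snd p)) > z}"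
  define f where "f p = norm (wave_sum I (coeffs \<omega>) (fst p) (snd p))" for p
  have "continuous_on UNIV f"
    using continuous_on_norm[OF continuous_on_wave_sum] unfolding f_def by (simp add: case_prod_beta)
  then have "open (f -` {z + e<..})" by (intro open_vimage open_greaterThan)
  moreover have "(0, 0) \<in> f -` {z + e<..}" using z unfolding f_def by simp
  ultimately obtain U V where U: "open U" "0 \<in> U" and V: "open V" "0 \<in> V" and UV: "U \<times> V \<subseteq> f -` {z + e<..}"
    by (rule open_prod_elim) auto
  obtain d1 where d1: "d1 > 0" "cball 0 d1 \<subseteq> U" using U open_contains_cball by metis
  obtain d2 where d2: "d2 > 0" "cball 0 d2 \<subseteq> V" using V open_contains_cball by metis
  define a where "a = min d1 T"
  define b where "b = min d2 (2 * pi)"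
  have ab: "a > 0" "b > 0" unfolding a_def b_def using d1 d2 T by auto
  have "{0..a} \<subseteq> U" "{0..b} \<subseteq> V" using d1(2) d2(2) unfolding a_def b_def by (force simp: dist_norm)+
  then have "f p > z + e" if "p \<in> {0..a} \<times> {0..b}" for p using UV that by fastforce
  then have "norm (free_evolution (coeffs \<omega>) (fst p) (snd p)) > z" if "p \<in> {0..a} \<times> {0..b}" for p
    using that e[of "fst p" "snd p"] norm_triangle_sub[of "wave_sum I (coeffs \<omega>) (fst p) (snd p)" "free_evolution (coeffs \<omega>) (fst p) (snd p)"]
    unfolding f_def by (fastforce simp: norm_minus_commute)
  then have sub: "{0..a} \<times> {0..b} \<subseteq> ?A" unfolding a_def b_def by auto
  have [measurable]: "(\<lambda>p. free_evolution (coeffs \<omega>) (fst p) (snd p)) \<in> borel_measurable borel"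
    by (rule free_evolution_measurable[OF w])
  have [measurable]: "{0..T} \<times> {0..2 * pi} \<in> sets borel" by (intro borel_closed closed_Times closed_atLeastAtMost)
  have "0 < ennreal a * ennreal b" using ab by (simp add: ennreal_zero_less_mult_iff)
  also have "\<dots> = emeasure (lborel \<Otimes>\<^sub>M lborel) ({0..a} \<times> {0..b})"
    by (subst lborel.emeasure_pair_measure_Times) (use ab in auto)
  also have "\<dots> \<le> emeasure lborel ?A"
    unfolding lborel_prod using sub by (rule emeasure_mono) simp
  finally show ?thesis
    unfolding deviation_def using w Linfty_norm_tx_gt_iff[OF free_evolution_measurable[OF w]] by simp
qed

text \<open>The real part of a long partial sum at the origin is a single normal variable of
  variance close to total_var / 2. Its large values occur with probability at least a multiple of
  exp (- v R^2), against which a tail event of rate v + 1 is negligible.\<close>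

lemma prob_deviation_ge:
  assumes z0: "z0 > 0" and v: "v > z0\<^sup>2 / total_var"
  obtains D where "D > 0" "\<forall>\<^sub>F R in at_top. \<forall>T>0. prob (deviation T (z0 * R)) \<ge> D * exp (- (v * R\<^sup>2))"
proof -
  let ?W = "z0\<^sup>2 / total_var"
  have W: "?W > 0" using z0 total_var_pos by simp
  then have v0: "v > 0" using v by simp
  obtain v' where v': "?W < v'" "v' < v" using dense[OF v] by auto
  then have v'0: "v' > 0" using W by simp
  \<comment> \<open>The level of rate v', hence above z0. With z1 in between, z1 - z0 absorbs the
    tail and z2 - z1 the shift by 1 in \<open>normal_tail_ge\<close>.\<close>
  define z2 where "z2 = sqrt (v' * total_var)"
  have z2: "z2 > 0" "z2\<^sup>2 = v' * total_var" unfolding z2_def using v'0 total_var_pos by auto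
  have "z0\<^sup>2 < z2\<^sup>2" using v'(1) total_var_pos z2(2) by (simp add: divide_less_eq)
  then have "z0 < z2" by (rule power2_less_imp_less) (use z2 in simp)
  then obtain z1 where z1: "z0 < z1" "z1 < z2" using dense by blast
  define \<eta> where "\<eta> = z1 - z0"
  have eta: "\<eta> > 0" unfolding \<eta>_def using z1 by simp
  \<comment> \<open>A partial variance s above this number gives z2^2 / s <= v.\<close>
  have "v' * total_var / v < total_var" using v'(2) v0 total_var_pos by (simp add: divide_less_eq)
  then obtain K\<^sub>1 where K1: "\<And>K. K \<ge> K\<^sub>1 \<Longrightarrow> v' * total_var / v < (\<Sum>n\<in>{- int (2 ^ K - 1)..int (2 ^ K - 1)}. (c n)\<^sup>2)"
    using symmetric_partial_var by metis
  \<comment> \<open>The extra 1 supplies a factor exp (- R^2), which brings the tail below half of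
    the main term for large R.\<close>
  have v1: "v + 1 > 0" using v0 by simp
  obtain D\<^sub>1 K\<^sub>0 where D1: "D\<^sub>1 > 0" and K0:
    "\<And>K R. K \<ge> K\<^sub>0 \<Longrightarrow> R \<ge> 1 \<Longrightarrow> \<exists>E\<in>events. prob E \<le> D\<^sub>1 * exp (- ((v + 1) * R\<^sup>2)) \<and>
       (\<forall>\<omega>\<in>space M - E. \<forall>t x. norm (free_evolution (coeffs \<omega>) t x
           - wave_sum {- int (2 ^ K - 1)..int (2 ^ K - 1)} (coeffs \<omega>) t x) \<le> \<eta> * R)"
    by (rule tail_event[OF eta v1], rule that)
  define K where "K = max K\<^sub>0 K\<^sub>1"
  define I where "I = {- int (2 ^ K - 1)..int (2 ^ K - 1)}"
  have "finite I" "0 \<in> I" unfolding I_def atLeastAtMost_iff by (rule finite_atLeastAtMost_int, linarith)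
  then have I: "finite I" "I \<noteq> {}" by auto
  define s where "s = (\<Sum>n\<in>I. (c n)\<^sup>2)"
  have s: "v' * total_var / v < s" unfolding s_def I_def by (rule K1) (simp add: K_def)
  have "v' * total_var / v > 0" using v'0 v0 total_var_pos by simp
  then have s0: "s > 0" using s by linarith
  have z2s: "z2\<^sup>2 / s \<le> v" using s s0 v0 z2(2) by (simp add: field_simps)
  \<comment> \<open>The prefactor of the normal density of variance s / 2.\<close>
  define d where "d = 1 / sqrt (pi * s)"
  have d: "d > 0" unfolding d_def using s0 by simp
  have D: "distributed M lborel (\<lambda>\<omega>. Re (wave_sum I (coeffs \<omega>) 0 0)) (normal_density 0 (sqrt (s / 2)))"
    using normal_sum_complex_gaussian[OF indep_vars_subset[OF indep] gauss I c_pos, of 0 "\<lambda>n. 0"]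
    by (simp add: wave_sum_def s_def)
  have "((\<lambda>R. D\<^sub>1 * exp (- R\<^sup>2)) \<longlongrightarrow> 0) at_top" by real_asymp
  then have "\<forall>\<^sub>F R in at_top. D\<^sub>1 * exp (- R\<^sup>2) < d / 2"
    by (rule order_tendstoD(2)) (use d in simp)
  moreover have "\<forall>\<^sub>F R in at_top. R \<ge> 1 / (z2 - z1)" by (rule eventually_ge_at_top)
  moreover have "\<forall>\<^sub>F R in at_top. R \<ge> (1::real)" by (rule eventually_ge_at_top)
  ultimately have "\<forall>\<^sub>F R in at_top. \<forall>T>0. prob (deviation T (z0 * R)) \<ge> d / 2 * exp (- (v * R\<^sup>2))"
  proof (eventually_elim, intro allI impI)
    fix R T :: real
    assume small: "D\<^sub>1 * exp (- R\<^sup>2) < d / 2" and Rz: "R \<ge> 1 / (z2 - z1)" and R: "R \<ge> 1" and T: "T > 0"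
    obtain E where E: "E \<in> events" "prob E \<le> D\<^sub>1 * exp (- ((v + 1) * R\<^sup>2))"
      "\<And>\<omega> t x. \<omega> \<in> space M - E \<Longrightarrow> norm (free_evolution (coeffs \<omega>) t x - wave_sum I (coeffs \<omega>) t x) \<le> \<eta> * R"
      using K0[of K R] R unfolding I_def K_def by auto
    define G where "G = {\<omega> \<in> space M. Re (wave_sum I (coeffs \<omega>) 0 0) > z1 * R}"
    have "G \<subseteq> deviation T (z0 * R) \<union> E"
    proof
      fix \<omega> assume w: "\<omega> \<in> G"
      have "norm (wave_sum I (coeffs \<omega>) 0 0) > z0 * R + \<eta> * R"
        using w complex_Re_le_cmod[of "wave_sum I (coeffs \<omega>) 0 0"]
        unfolding G_def \<eta>_def by (auto simp: algebra_simps)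
      then show "\<omega> \<in> deviation T (z0 * R) \<union> E"
        using Linfty_norm_tx_gt_of_wave_sum[OF _ T] E(3) w unfolding G_def by blast
    qed
    then have "prob G \<le> prob (deviation T (z0 * R) \<union> E)"
      by (rule finite_measure_mono) (use E deviation_events in auto)
    also have "\<dots> \<le> prob (deviation T (z0 * R)) + prob E"
      by (rule measure_Un_le) (use E deviation_events in auto)
    finally have 1: "prob G - prob E \<le> prob (deviation T (z0 * R))" by simp
    have "1 / sqrt (2 * pi * (sqrt (s / 2))\<^sup>2) * exp (- (z1 * R + 1)\<^sup>2 / (2 * (sqrt (s / 2))\<^sup>2)) \<le> prob G"
      unfolding G_def by (rule normal_tail_ge[OF D]) (use z1 z0 R s0 in auto)
    then have 2: "d * exp (- ((z1 * R + 1)\<^sup>2 / s)) \<le> prob G"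
      using s0 unfolding d_def by simp
    have "z1 * R + 1 \<le> z2 * R" using Rz z1 by (simp add: divide_le_eq algebra_simps)
    then have "(z1 * R + 1)\<^sup>2 / s \<le> (z2 * R)\<^sup>2 / s"
      using z1 z0 R s0 by (intro divide_right_mono power_mono) auto
    also have "\<dots> = z2\<^sup>2 / s * R\<^sup>2" by (simp add: power_mult_distrib)
    also have "\<dots> \<le> v * R\<^sup>2" using z2s by (intro mult_right_mono) auto
    finally have "d * exp (- (v * R\<^sup>2)) \<le> d * exp (- ((z1 * R + 1)\<^sup>2 / s))" using d by simp
    then have 3: "d * exp (- (v * R\<^sup>2)) \<le> prob G" using 2 by linarith
    have "D\<^sub>1 * exp (- ((v + 1) * R\<^sup>2)) = D\<^sub>1 * exp (- R\<^sup>2) * exp (- (v * R\<^sup>2))"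
      by (simp add: ring_distribs mult.assoc flip: exp_add)
    also have "\<dots> \<le> d / 2 * exp (- (v * R\<^sup>2))" using small by (intro mult_right_mono) auto
    finally show "prob (deviation T (z0 * R)) \<ge> d / 2 * exp (- (v * R\<^sup>2))"
      using 1 3 E(2) by simp
  qed
  then show ?thesis using that[of "d / 2"] d by simp
qed

end

section \<open>The logarithmic limit\<close>

theorem lemma3p4:
  fixes M :: "'w measure"
    and g :: "int \<Rightarrow> 'w \<Rightarrow> complex"
    and c :: "int \<Rightarrow> real"
    and \<theta> z0 :: real
    and T :: "real \<Rightarrow> real"
  assumes "prob_space M"
    and "\<theta> > 0"
    and "\<And>n. c n = japanese_bracket n powr (- (1 / 2 + \<theta>))"
    and "z0 > 0"
    and "prob_space.indep_vars M (\<lambda>_. borel) g UNIV"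
    and "\<And>n. standard_complex_gaussian M (g n)"
    and "\<And>\<epsilon>. \<epsilon> > 0 \<Longrightarrow> T \<epsilon> > 0"
    and "T \<in> O[at_right 0](\<lambda>\<epsilon>. 1 / \<epsilon>)"
  shows "((\<lambda>\<epsilon>. \<epsilon> * ln (measure M {\<omega> \<in> space M.
              Linfty_norm_tx (T \<epsilon>) (free_evolution (\<lambda>n. complex_of_real (c n) * g n \<omega>))
                > ereal (z0 * \<epsilon> powr (- 1 / 2))}))
          \<longlongrightarrow> - (z0\<^sup>2 / (\<Sum>\<^sub>\<infinity>n\<in>UNIV. (c n)\<^sup>2))) (at_right 0)"
proof -
  interpret prob_space M by fact
  interpret gaussian_fourier_series M g c \<theta>
    by unfold_locales (use assms in auto)
  \<comment> \<open>With R = \<epsilon> powr (- 1 / 2) the Gaussian bounds in R^2 take the form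
    required by \<open>tendsto_scaled_ln\<close>.\<close>
  have sq: "(\<epsilon> powr (- 1 / 2))\<^sup>2 = 1 / \<epsilon>" if "\<epsilon> > 0" for \<epsilon> :: real
    unfolding power2_eq_square powr_add[symmetric] using that by (simp add: powr_minus_divide)
  have pos: "\<forall>\<^sub>F \<epsilon> in at_right 0. \<epsilon> > (0::real)" by (rule eventually_at_right_less)
  have R_top: "filterlim (\<lambda>\<epsilon>::real. \<epsilon> powr (- 1 / 2)) at_top (at_right 0)" by real_asymp
  have "((\<lambda>\<epsilon>. \<epsilon> * ln (prob (deviation (T \<epsilon>) (z0 * \<epsilon> powr (- 1 / 2))))) \<longlongrightarrow> - (z0\<^sup>2 / total_var)) (at_right 0)"
  proof (rule tendsto_scaled_ln)
    fix w assume w: "w < z0\<^sup>2 / total_var"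
    obtain D where D: "D > 0" "\<And>R T. R \<ge> 1 \<Longrightarrow> prob (deviation T (z0 * R)) \<le> D * exp (- (w * R\<^sup>2))"
      by (rule prob_deviation_le[OF assms(4) w], rule that)
    have "\<forall>\<^sub>F \<epsilon> in at_right 0. \<epsilon> powr (- 1 / 2) \<ge> (1::real)"
      using R_top by (simp add: filterlim_at_top)
    with pos have "\<forall>\<^sub>F \<epsilon> in at_right 0. prob (deviation (T \<epsilon>) (z0 * \<epsilon> powr (- 1 / 2))) \<le> D * exp (- (w / \<epsilon>))"
    proof eventually_elim
      case (elim \<epsilon>)
      then show ?case using D(2)[OF elim(2), of "T \<epsilon>"] sq[OF elim(1)] by simp
    qed
    with D(1) show "\<exists>D>0. \<forall>\<^sub>F \<epsilon> in at_right 0. prob (deviation (T \<epsilon>) (z0 * \<epsilon> powr (- 1 / 2))) \<le> D * exp (- (w / \<epsilon>))"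
      by blast
  next
    fix v assume v: "v > z0\<^sup>2 / total_var"
    \<comment> \<open>T is quantified inside the eventuality, so one threshold for R serves although
      T varies with \<epsilon>.\<close>
    obtain D where D: "D > 0" "\<forall>\<^sub>F R in at_top. \<forall>T>0. prob (deviation T (z0 * R)) \<ge> D * exp (- (v * R\<^sup>2))"
      by (rule prob_deviation_ge[OF assms(4) v], rule that)
    from eventually_compose_filterlim[OF D(2) R_top] pos
    have "\<forall>\<^sub>F \<epsilon> in at_right 0. prob (deviation (T \<epsilon>) (z0 * \<epsilon> powr (- 1 / 2))) \<ge> D * exp (- (v / \<epsilon>))"
    proof eventually_elim
      case (elim \<epsilon>)
      then show ?case using sq[OF elim(2)] assms(7)[OF elim(2)] by simp
    qed
    with D(1) show "\<exists>D>0. \<forall>\<^sub>F \<epsilon> in at_right 0. prob (deviation (T \<epsilon>) (z0 * \<epsilon> powr (- 1 / 2))) \<ge> D * exp (- (v / \<epsilon>))"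
      by blast
  qed
  then show ?thesis unfolding deviation_def total_var_def .
qed

end
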